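(* Let $(X,f)$ be a topological dynamical system, let $\mu$ be an $f$-invariant ergodic Borel probability measure and let $\phi:X\to\mathbb{R}$ be a continuous potential. Then for every mistake function $g$, $$P_\mu(f,\phi)=\lim_{\varepsilon\to 0}\limsup_{n\to\infty}\frac{1}{n}\log\left[e^{S_n\phi(B_n(g;x,\varepsilon))}\,R_n(g;x,\varepsilon)\right]$$ for $\mu$-almost every $x\in X$, where $S_n\phi(B_n(g;x,\varepsilon))=\sup\left\{\sum_{i=0}^{n-1}\phi(f^i y): y\in B_n(g;x,\varepsilon)\right\}$.
   Context: A topological dynamical system $(X,f)$ is a continuous map $f:X\to X$ on a compact metric space $(X,d)$. The measure-theoretic pressure is $P_\mu(f,\phi)=h_\mu(f)+\int\phi\,\mathrm{d}\mu$, where $h_\mu(f)$ is the measure-theoretic entropy. Mistake function: given $\varepsilon_0>0$, a function $g:\mathbb{N}\times(0,\varepsilon_0]\to\mathbb{N}$ is a mistake function if for all $\varepsilon\in(0,\varepsilon_0]$ and all $n\in\mathbb{N}$, $g(n,\varepsilon)\le g(n+1,\varepsilon)$ and $\lim_{n\to\infty} g(n,\varepsilon)/n=0$. One sets $g(n,\varepsilon)=g(n,\varepsilon_0)$ for $\varepsilon>\varepsilon_0$. For a finite set of integers $\Lambda\subset[0,N]$ let $d_\Lambda(x,y)=\max\{d(f^i x,f^i y): i\in\Lambda\}$ and $B_\Lambda(x,\varepsilon)=\{y\in X: d_\Lambda(x,y)<\varepsilon\}$. For $n\ge 1$ and $\varepsilon>0$ let $I(g;n,\varepsilon)=\{\Lambda\subset[0,n-1]\cap\mathbb{N}: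 \#\Lambda\ge n-g(n,\varepsilon)\}$ (here $0\in\mathbb{N}$). The mistake dynamical ball is $B_n(g;x,\varepsilon)=\bigcup_{\Lambda\in I(g;n,\varepsilon)}B_\Lambda(x,\varepsilon)$. First return time: $R_n(g;x,\varepsilon)=\inf\{k\ge 1: f^k(x)\in B_n(g;x,\varepsilon)\}$. *)

theory Defs
  imports "HOL-Probability.Probability" "HOL-Library.Disjoint_Sets"
begin

definition invariant_measure :: "('a \<Rightarrow> 'a) \<Rightarrow> 'a measure \<Rightarrow> bool" where
  "invariant_measure f M \<longleftrightarrow> f \<in> measurable M M \<and> distr M M f = M"

definition ergodic_measure :: "('a \<Rightarrow> 'a) \<Rightarrow> 'a measure \<Rightarrow> bool" where
  "ergodic_measure f M \<longleftrightarrow>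
     (\<forall>A\<in>sets M. f -` A \<inter> space M = A \<longrightarrow> measure M A = 0 \<or> measure M A = 1)"

definition finite_measurable_partition :: "'a measure \<Rightarrow> 'a set set \<Rightarrow> bool" where
  "finite_measurable_partition M P \<longleftrightarrow>
     finite P \<and> P \<subseteq> sets M \<and> partition_on (space M) P"

text \<open>Null cells contribute \<open>0\<close>, in accordance with the usual convention \<open>0 log 0 = 0\<close>.\<close>

definition partition_entropy :: "'a measure \<Rightarrow> 'a set set \<Rightarrow> real" where
  "partition_entropy M P = - (\<Sum>A\<in>P. measure M A * ln (measure M A))"

text \<open>The join of the preimages of \<open>P\<close> under \<open>f ^^ i\<close>, \<open>i < n\<close>. Empty preimages may occur in the
  family, but \<open>common_refinement\<close> discards empty cells.\<close>

definition iterated_partition :: "'a measure \<Rightarrow> ('a \<Rightarrow> 'a) \<Rightarrow> 'a set set \<Rightarrow> nat \<Rightarrow> 'a set set" where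
  "iterated_partition M f P n =
     common_refinement ((\<lambda>i. (\<lambda>A. (f ^^ i) -` A \<inter> space M) ` P) ` {..<n})"

definition entropy_wrt_partition :: "'a measure \<Rightarrow> ('a \<Rightarrow> 'a) \<Rightarrow> 'a set set \<Rightarrow> real" where
  "entropy_wrt_partition M f P =
     lim (\<lambda>n. partition_entropy M (iterated_partition M f P n) / real n)"

definition measure_entropy :: "'a measure \<Rightarrow> ('a \<Rightarrow> 'a) \<Rightarrow> ereal" where
  "measure_entropy M f =
     (SUP P\<in>{P. finite_measurable_partition M P}. ereal (entropy_wrt_partition M f P))"

definition measure_pressure :: "'a measure \<Rightarrow> ('a \<Rightarrow> 'a) \<Rightarrow> ('a \<Rightarrow> real) \<Rightarrow> ereal" where
  "measure_pressure M f \<phi> = measure_entropy M f + ereal (\<integral>x. \<phi> x \<partial>M)"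

definition mistake_function :: "real \<Rightarrow> (nat \<Rightarrow> real \<Rightarrow> nat) \<Rightarrow> bool" where
  "mistake_function \<epsilon>\<^sub>0 g \<longleftrightarrow> \<epsilon>\<^sub>0 > 0 \<and>
     (\<forall>\<epsilon>\<in>{0<..\<epsilon>\<^sub>0}. (\<forall>n. g n \<epsilon> \<le> g (Suc n) \<epsilon>) \<and> (\<lambda>n. real (g n \<epsilon>) / real n) \<longlonglongrightarrow> 0)"

text \<open>A mistake function is only meaningful on \<open>{0<..\<epsilon>\<^sub>0}\<close>; beyond \<open>\<epsilon>\<^sub>0\<close> its value at \<open>\<epsilon>\<^sub>0\<close> is used.\<close>

definition extend_mistake :: "real \<Rightarrow> (nat \<Rightarrow> real \<Rightarrow> nat) \<Rightarrow> nat \<Rightarrow> real \<Rightarrow> nat" where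
  "extend_mistake \<epsilon>\<^sub>0 g n \<epsilon> = (if \<epsilon> > \<epsilon>\<^sub>0 then g n \<epsilon>\<^sub>0 else g n \<epsilon>)"

text \<open>Distances being nonnegative, inserting \<open>0\<close> only matters for \<open>\<Lambda> = {}\<close>: then the
  distance is \<open>0\<close> and every ball of positive radius is the whole space.\<close>

definition dyn_dist :: "('a::metric_space \<Rightarrow> 'a) \<Rightarrow> nat set \<Rightarrow> 'a \<Rightarrow> 'a \<Rightarrow> real" where
  "dyn_dist f \<Lambda> x y = Max (insert 0 ((\<lambda>i. dist ((f ^^ i) x) ((f ^^ i) y)) ` \<Lambda>))"

definition dyn_ball :: "('a::metric_space \<Rightarrow> 'a) \<Rightarrow> nat set \<Rightarrow> 'a \<Rightarrow> real \<Rightarrow> 'a set" where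
  "dyn_ball f \<Lambda> x \<epsilon> = {y. dyn_dist f \<Lambda> x y < \<epsilon>}"

text \<open>The truncated subtraction is harmless, since cardinalities are nonnegative.\<close>

definition mistake_index_sets :: "(nat \<Rightarrow> real \<Rightarrow> nat) \<Rightarrow> nat \<Rightarrow> real \<Rightarrow> nat set set" where
  "mistake_index_sets g n \<epsilon> = {\<Lambda>. \<Lambda> \<subseteq> {..<n} \<and> card \<Lambda> \<ge> n - g n \<epsilon>}"

definition mistake_ball ::
  "('a::metric_space \<Rightarrow> 'a) \<Rightarrow> (nat \<Rightarrow> real \<Rightarrow> nat) \<Rightarrow> nat \<Rightarrow> 'a \<Rightarrow> real \<Rightarrow> 'a set" where
  "mistake_ball f g n x \<epsilon> = (\<Union>\<Lambda>\<in>mistake_index_sets g n \<epsilon>. dyn_ball f \<Lambda> x \<epsilon>)"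

text \<open>The value is \<open>\<infinity>\<close> if the orbit never returns.\<close>

definition return_time ::
  "('a::metric_space \<Rightarrow> 'a) \<Rightarrow> (nat \<Rightarrow> real \<Rightarrow> nat) \<Rightarrow> nat \<Rightarrow> 'a \<Rightarrow> real \<Rightarrow> enat" where
  "return_time f g n x \<epsilon> = Inf {enat k | k. k \<ge> 1 \<and> (f ^^ k) x \<in> mistake_ball f g n x \<epsilon>}"

definition birkhoff_sum :: "('a \<Rightarrow> 'a) \<Rightarrow> ('a \<Rightarrow> real) \<Rightarrow> nat \<Rightarrow> 'a \<Rightarrow> real" where
  "birkhoff_sum f \<phi> n y = (\<Sum>i<n. \<phi> ((f ^^ i) y))"

definition birkhoff_sup :: "('a \<Rightarrow> 'a) \<Rightarrow> ('a \<Rightarrow> real) \<Rightarrow> nat \<Rightarrow> 'a set \<Rightarrow> real" where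
  "birkhoff_sup f \<phi> n B = (SUP y\<in>B. birkhoff_sum f \<phi> n y)"

definition ln_ereal :: "ereal \<Rightarrow> ereal" where
  "ln_ereal t = (if t \<le> 0 then -\<infinity> else if t = \<infinity> then \<infinity> else ereal (ln (real_of_ereal t)))"

end

theory Submission
  imports Defs
begin

text \<open>
  By Birkhoff's theorem, uniform continuity of \<open>\<phi>\<close> and \<open>g(n, \<epsilon>) = o(n)\<close>, the supremum of
  \<open>S\<^sub>n \<phi>\<close> over the mistake ball contributes \<open>\<integral>\<phi> d\<mu>\<close> up to an error vanishing with \<open>\<epsilon>\<close>, so it remains
  to show that return times grow at the rate \<open>h\<^sub>\<mu>(f)\<close>.

  Upper bound: a mistake ball contains the cylinder of \<open>x\<close> for any partition of diameter
  below \<open>\<epsilon>\<close>. If \<open>q\<close> is a subprobability on words of length \<open>n\<close>, the points of a cylinder \<open>w\<close>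
  which do not return to it within time \<open>e\<^sup>n\<^sup>\<delta> / q(w)\<close> have measure at most \<open>q(w) e\<^sup>-\<^sup>n\<^sup>\<delta>\<close>. For
  the \<open>k\<close>-step Markov approximation \<open>q\<close> of the partition process, \<open>-ln q(w) / n\<close> tends to
  \<open>H\<^sub>k\<^sub>+\<^sub>1 - H\<^sub>k\<close> by Birkhoff's theorem, and Borel--Cantelli applies.

  Lower bound: let \<open>h < h\<^sub>\<mu>(f)\<close>. The points whose mistake balls of every small radius have return times
  at most \<open>e\<^sup>n\<^sup>h\<close> for all large \<open>n\<close> form a subinvariant set, of measure 0 or 1. If it had
  measure 1, most blocks of length \<open>n\<close> of an orbit could be described, up to few errors, by one of
  \<open>e\<^sup>n\<^sup>h\<close> distances to an earlier decoded copy. Decoding from right to left, this gives a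
  subprobability on words whose expected code length is at most about \<open>h\<close> per letter, so by Gibbs'
  inequality every partition would have entropy at most \<open>h\<close>. To tolerate nearby instead of equal
  points, the cells are replaced by closed subsets, which have disjoint neighbourhoods.
\<close>

section \<open>The ergodic theorem\<close>

lemma birkhoff_sum_Suc: "birkhoff_sum f \<psi> (Suc n) x = \<psi> x + birkhoff_sum f \<psi> n (f x)"
  unfolding birkhoff_sum_def sum.lessThan_Suc_shift by (simp add: funpow_swap1)

lemma birkhoff_sum_0 [simp]: "birkhoff_sum f \<psi> 0 x = 0"
  by (simp add: birkhoff_sum_def)

lemma birkhoff_sum_add:
  "birkhoff_sum f \<psi> (m + n) x = birkhoff_sum f \<psi> m x + birkhoff_sum f \<psi> n ((f ^^ m) x)"
  by (induction m arbitrary: x) (auto simp: birkhoff_sum_Suc funpow_swap1)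

lemma birkhoff_sum_diff_const:
  "birkhoff_sum f (\<lambda>x. \<psi> x - c) n x = birkhoff_sum f \<psi> n x - real n * c"
  by (simp add: birkhoff_sum_def sum_subtractf)

section \<open>Measure-preserving maps and the maximal inequality\<close>

locale mpt = prob_space M for M :: "'a measure" +
  fixes f :: "'a \<Rightarrow> 'a"
  assumes space_UNIV [simp]: "space M = UNIV"
    and f_measurable [measurable]: "f \<in> measurable M M"
    and distr_f: "distr M M f = M"
begin

lemma funpow_measurable [measurable]: "(f ^^ n) \<in> measurable M M"
  by (induction n) (auto simp: o_def)

lemma distr_funpow: "distr M M (f ^^ n) = M"
proof (induction n)
  case 0
  show ?case by (simp add: distr_id2 id_def)
next
  case (Suc n)
  have "distr M M (f ^^ Suc n) = distr (distr M M (f ^^ n)) M f"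
    by (simp add: distr_distr o_def)
  then show ?case by (simp only: Suc distr_f)
qed

lemma measure_funpow_vimage:
  assumes "A \<in> sets M"
  shows "measure M ((f ^^ n) -` A) = measure M A"
  using measure_distr[of "f ^^ n" M M A] assms by (simp add: distr_funpow)

lemma integral_funpow:
  fixes h :: "'a \<Rightarrow> real"
  assumes "h \<in> borel_measurable M"
  shows "(\<integral>x. h ((f ^^ n) x) \<partial>M) = (\<integral>x. h x \<partial>M)"
  using integral_distr[of "f ^^ n" M M h] assms by (simp add: distr_funpow)

lemma AE_funpow:
  assumes "AE x in M. P x"
  shows "AE x in M. \<forall>n. P ((f ^^ n) x)"
proof (subst AE_all_countable, intro allI)
  fix n
  have "AE x in distr M M (f ^^ n). P x" unfolding distr_funpow by (rule assms)
  then show "AE x in M. P ((f ^^ n) x)"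
    by (rule AE_distrD[rotated]) measurable
qed

lemma birkhoff_sum_measurable [measurable]:
  assumes [measurable]: "\<psi> \<in> borel_measurable M"
  shows "birkhoff_sum f \<psi> n \<in> borel_measurable M"
  unfolding birkhoff_sum_def by measurable

lemma integrable_bounded:
  fixes \<psi> :: "'a \<Rightarrow> real"
  assumes "\<psi> \<in> borel_measurable M" "\<And>x. \<bar>\<psi> x\<bar> \<le> B"
  shows "integrable M \<psi>"
  using assms by (intro integrable_const_bound[of _ B]) auto

lemma integral_birkhoff_sum:
  assumes [measurable]: "\<psi> \<in> borel_measurable M" and "\<And>x. \<bar>\<psi> x\<bar> \<le> B"
  shows "(\<integral>x. birkhoff_sum f \<psi> n x \<partial>M) = real n * (\<integral>x. \<psi> x \<partial>M)"
proof -
  have "integrable M (\<lambda>x. \<psi> ((f ^^ i) x))" for i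
    by (rule integrable_bounded[where B = B]) (use assms in auto)
  then show ?thesis
    unfolding birkhoff_sum_def by (simp add: integral_funpow)
qed

text \<open>Garsia's argument: with $S_n$ the Birkhoff sums, this is $\max_{n \le N} S_n$, and
  $m_N - m_N \circ f \le \psi$ where $m_N > 0$.\<close>

fun birkhoff_max :: "('a \<Rightarrow> real) \<Rightarrow> nat \<Rightarrow> 'a \<Rightarrow> real" where
  "birkhoff_max \<psi> 0 x = 0"
| "birkhoff_max \<psi> (Suc N) x = max 0 (\<psi> x + birkhoff_max \<psi> N (f x))"

lemma birkhoff_max_nonneg: "0 \<le> birkhoff_max \<psi> N x"
  by (cases N) auto

lemma birkhoff_max_mono: "birkhoff_max \<psi> N x \<le> birkhoff_max \<psi> (Suc N) x"
proof (induction N arbitrary: x)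
  case (Suc N)
  show ?case using Suc[of "f x"] by simp
qed simp

lemma birkhoff_sum_le_max: "n \<le> N \<Longrightarrow> birkhoff_sum f \<psi> n x \<le> birkhoff_max \<psi> N x"
proof (induction N arbitrary: n x)
  case (Suc N)
  show ?case
  proof (cases n)
    case (Suc m)
    with Suc.IH[of m "f x"] Suc.prems show ?thesis by (simp add: birkhoff_sum_Suc)
  qed simp
qed simp

lemma birkhoff_max_measurable [measurable]:
  assumes [measurable]: "\<psi> \<in> borel_measurable M"
  shows "birkhoff_max \<psi> N \<in> borel_measurable M"
proof (induction N)
  case (Suc N)
  note [measurable] = Suc
  have "birkhoff_max \<psi> (Suc N) = (\<lambda>x. max 0 (\<psi> x + birkhoff_max \<psi> N (f x)))" by auto
  then show ?case by simp
qed (simp add: fun_eq_iff cong: measurable_cong)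

lemma birkhoff_max_bounded:
  assumes "\<And>x. \<bar>\<psi> x\<bar> \<le> B"
  shows "\<bar>birkhoff_max \<psi> N x\<bar> \<le> real N * B"
proof (induction N arbitrary: x)
  case (Suc N)
  have "0 \<le> B" using assms[of x] by linarith
  then show ?case using Suc[of "f x"] assms[of x] by (auto simp: max_def algebra_simps)
qed simp

text \<open>The function \<open>m_N - m_N o f\<close> has integral 0 by invariance and is at most
  \<psi> where \<open>m_N > 0\<close> and at most 0 elsewhere. So \<psi> has nonnegative integral
  over \<open>{m_N > 0}\<close>, and by \<open>pos\<close> these sets increase to almost the whole
  space; dominated convergence concludes.\<close>

lemma maximal_ergodic_inequality:
  assumes [measurable]: "\<psi> \<in> borel_measurable M" and B: "\<And>x. \<bar>\<psi> x\<bar> \<le> B"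
    and pos: "AE x in M. \<exists>n. birkhoff_sum f \<psi> n x > 0"
  shows "0 \<le> (\<integral>x. \<psi> x \<partial>M)"
proof -
  let ?m = "\<lambda>N. birkhoff_max \<psi> (Suc N)"
  let ?h = "\<lambda>N x. \<psi> x * indicator {x. ?m N x > 0} x"
  have h: "0 \<le> (\<integral>x. ?h N x \<partial>M)" for N
  proof -
    have i: "integrable M (?m N)"
      by (rule integrable_bounded, measurable, rule birkhoff_max_bounded[OF B])
    have i': "integrable M (\<lambda>x. ?m N (f x))"
      by (rule integrable_bounded, measurable, rule birkhoff_max_bounded[OF B])
    have ih: "integrable M (?h N)"
    proof (rule integrable_bounded)
      show "?h N \<in> borel_measurable M" by measurable
      show "\<bar>?h N x\<bar> \<le> B" for x
        using B[of x] by (auto simp: indicator_def)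
    qed
    have "(\<integral>x. ?m N x - ?m N (f x) \<partial>M) \<le> (\<integral>x. ?h N x \<partial>M)"
    proof (rule integral_mono[OF Bochner_Integration.integrable_diff[OF i i'] ih])
      fix x
      show "?m N x - ?m N (f x) \<le> ?h N x"
      proof (cases "?m N x > 0")
        case True
        then have "?m N x = \<psi> x + birkhoff_max \<psi> N (f x)" by (auto simp: max_def split: if_splits)
        then show ?thesis using True birkhoff_max_mono[of \<psi> N "f x"] by simp
      next
        case False
        then have "?m N x = 0" using birkhoff_max_nonneg[of \<psi> "Suc N" x] by linarith
        then show ?thesis using False birkhoff_max_nonneg[of \<psi> "Suc N" "f x"] by simp
      qed
    qed
    moreover have "(\<integral>x. ?m N x - ?m N (f x) \<partial>M) = 0"
      using i i' integral_funpow[of "?m N" 1] by (simp del: birkhoff_max.simps)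
    ultimately show ?thesis by linarith
  qed
  have "(\<lambda>N. \<integral>x. ?h N x \<partial>M) \<longlonglongrightarrow> (\<integral>x. \<psi> x \<partial>M)"
  proof (rule integral_dominated_convergence[where w = "\<lambda>_. B"])
    show "AE x in M. (\<lambda>N. ?h N x) \<longlonglongrightarrow> \<psi> x"
      using pos
    proof eventually_elim
      case (elim x)
      then obtain n where n: "birkhoff_sum f \<psi> n x > 0" by auto
      have "\<forall>\<^sub>F N in sequentially. ?h N x = \<psi> x"
        using eventually_ge_at_top[of n]
      proof eventually_elim
        case (elim N)
        then show ?case using n birkhoff_sum_le_max[of n "Suc N" \<psi> x] by simp
      qed
      then show ?case by (rule tendsto_eventually)
    qed
    show "AE x in M. norm (?h N x) \<le> B" for N
      using B by (auto simp: indicator_def intro: order_trans[OF _ B])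
  qed auto
  then show ?thesis by (rule LIMSEQ_le_const) (use h in auto)
qed

end

section \<open>Birkhoff's theorem for ergodic maps\<close>

locale ergodic_mpt = mpt +
  assumes ergodic: "ergodic_measure f M"
begin

text \<open>The preimages of \<open>A\<close> increase and all have the measure of \<open>A\<close>.
  Hence their union has this measure too, and the union is strictly invariant, so ergodicity applies
  to it.\<close>

lemma prob_subinvariant:
  assumes [measurable]: "A \<in> sets M" and sub: "\<And>x. x \<in> A \<Longrightarrow> f x \<in> A"
  shows "prob A = 0 \<or> prob A = 1"
proof -
  let ?A = "\<lambda>n. (f ^^ n) -` A"
  have A: "?A n \<in> sets M" for n
    using measurable_sets[OF funpow_measurable[of n], of A] by simp
  have "incseq ?A" by (rule incseq_SucI) (use sub in auto)
  then have "(\<lambda>n. prob (?A n)) \<longlonglongrightarrow> prob (\<Union>n. ?A n)"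
    by (intro finite_Lim_measure_incseq) (use A in auto)
  then have eq: "prob (\<Union>n. ?A n) = prob A"
    by (simp add: measure_funpow_vimage LIMSEQ_const_iff)
  have "f -` (\<Union>n. ?A n) = (\<Union>n. ?A n)"
  proof (intro equalityI subsetI)
    fix x assume "x \<in> f -` (\<Union>n. ?A n)"
    then obtain n where "(f ^^ n) (f x) \<in> A" by auto
    then have "x \<in> ?A (Suc n)" by (simp add: funpow_swap1)
    then show "x \<in> (\<Union>n. ?A n)" by blast
  next
    fix x assume "x \<in> (\<Union>n. ?A n)"
    then obtain n where "(f ^^ n) x \<in> A" by auto
    then have "(f ^^ n) (f x) \<in> A" using sub[of "(f ^^ n) x"] by (simp add: funpow_swap1)
    then show "x \<in> f -` (\<Union>n. ?A n)" by auto
  qed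
  then have "prob (\<Union>n. ?A n) = 0 \<or> prob (\<Union>n. ?A n) = 1"
    using ergodic A unfolding ergodic_measure_def by auto
  then show ?thesis using eq by simp
qed

text \<open>The points whose sums are unbounded above form a subinvariant set. If it had full
  measure, almost every point would have a positive sum, and the maximal inequality would contradict
  the negative integral.\<close>

lemma birkhoff_sum_bounded_above:
  assumes [measurable]: "\<psi> \<in> borel_measurable M" and B: "\<And>x. \<bar>\<psi> x\<bar> \<le> B"
    and neg: "(\<integral>x. \<psi> x \<partial>M) < 0"
  shows "AE x in M. \<exists>c::nat. \<forall>n. birkhoff_sum f \<psi> n x \<le> real c"
proof -
  let ?E = "{x. \<forall>c::nat. \<exists>n. birkhoff_sum f \<psi> n x > real c}"
  have [measurable]: "?E \<in> sets M"
  proof -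
    have "Measurable.pred M (\<lambda>x. \<forall>c::nat. \<exists>n. birkhoff_sum f \<psi> n x > real c)" by measurable
    then show ?thesis by (simp add: pred_def)
  qed
  have "f x \<in> ?E" if "x \<in> ?E" for x
  proof (clarify)
    fix c :: nat
    \<comment> \<open>The extra \<bar>B\<bar> absorbs the first term \<open>\<psi> x\<close>, which
      is lost in passing from \<open>x\<close> to \<open>f x\<close>.\<close>
    obtain d :: nat where d: "real d \<ge> real c + \<bar>B\<bar>" using real_arch_simple by blast
    obtain n where n: "birkhoff_sum f \<psi> n x > real d" using \<open>x \<in> ?E\<close> by auto
    then have "n \<noteq> 0" by (auto intro!: Nat.gr0I)
    then obtain m where "n = Suc m" using not0_implies_Suc by blast
    then show "\<exists>n. birkhoff_sum f \<psi> n (f x) > real c"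
      using n d B[of x] by (intro exI[of _ m]) (simp add: birkhoff_sum_Suc)
  qed
  then consider "prob ?E = 0" | "prob ?E = 1" using prob_subinvariant[of ?E] by auto
  then show ?thesis
  proof cases
    case 1
    then have "AE x in M. x \<notin> ?E" by (simp add: prob_eq_0)
    then show ?thesis by eventually_elim (auto simp: not_less)
  next
    case 2
    then have "AE x in M. x \<in> ?E" by (simp add: prob_eq_1)
    then have "AE x in M. \<exists>n. birkhoff_sum f \<psi> n x > 0"
    proof eventually_elim
      case (elim x)
      then have "\<exists>n. birkhoff_sum f \<psi> n x > real 0" by blast
      then show ?case by simp
    qed
    from maximal_ergodic_inequality[OF _ B this] neg show ?thesis by simp
  qed
qed

lemma birkhoff_upper:
  assumes [measurable]: "\<psi> \<in> borel_measurable M" and B: "\<And>x. \<bar>\<psi> x\<bar> \<le> B"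
    and c: "(\<integral>x. \<psi> x \<partial>M) < c"
  shows "AE x in M. \<forall>\<^sub>F n in sequentially. birkhoff_sum f \<psi> n x \<le> real n * c"
proof -
  \<comment> \<open>The midpoint leaves a gap \<open>n * (c - d)\<close>, which eventually exceeds
    any bound for the sums of \<open>\<psi> - d\<close>.\<close>
  define d where "d = ((\<integral>x. \<psi> x \<partial>M) + c) / 2"
  have d: "(\<integral>x. \<psi> x \<partial>M) < d" "d < c" using c by (auto simp: d_def)
  have "integrable M \<psi>" by (rule integrable_bounded[OF _ B]) simp
  then have "(\<integral>x. \<psi> x - d \<partial>M) < 0" using d prob_space by simp
  moreover have "\<bar>\<psi> x - d\<bar> \<le> B + \<bar>d\<bar>" for x using B[of x] by linarith
  ultimately have "AE x in M. \<exists>k::nat. \<forall>n. birkhoff_sum f (\<lambda>x. \<psi> x - d) n x \<le> real k"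
    by (intro birkhoff_sum_bounded_above) auto
  then show ?thesis
  proof eventually_elim
    case (elim x)
    then obtain k :: nat where k: "\<And>n. birkhoff_sum f \<psi> n x - real n * d \<le> real k"
      by (auto simp: birkhoff_sum_diff_const)
    have "\<forall>\<^sub>F n in sequentially. real k / (c - d) \<le> real n"
      using filterlim_real_sequentially by (auto simp: filterlim_at_top)
    then show ?case
    proof eventually_elim
      case (elim n)
      then have "real k \<le> real n * (c - d)" using d by (simp add: divide_simps)
      then show ?case using k[of n] by (simp add: algebra_simps)
    qed
  qed
qed

theorem birkhoff:
  assumes [measurable]: "\<psi> \<in> borel_measurable M" and B: "\<And>x. \<bar>\<psi> x\<bar> \<le> B"
  shows "AE x in M. (\<lambda>n. birkhoff_sum f \<psi> n x / real n) \<longlonglongrightarrow> (\<integral>x. \<psi> x \<partial>M)"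
proof -
  let ?I = "\<integral>x. \<psi> x \<partial>M"
  have up: "AE x in M. \<forall>m. \<forall>\<^sub>F n in sequentially. birkhoff_sum f \<psi> n x \<le> real n * (?I + 1 / Suc m)"
    by (subst AE_all_countable, intro allI birkhoff_upper[where B = B]) (use B in auto)
  have "AE x in M. \<forall>m. \<forall>\<^sub>F n in sequentially.
      birkhoff_sum f (\<lambda>x. - \<psi> x) n x \<le> real n * (- ?I + 1 / Suc m)"
    by (subst AE_all_countable, intro allI birkhoff_upper[where B = B]) (use B in auto)
  with up show ?thesis
  proof eventually_elim
    case (elim x)
    show ?case
    proof (rule LIMSEQ_I)
      fix r :: real assume "r > 0"
      then obtain m where m: "1 / Suc m < r" using nat_approx_posE by blast
      have "\<forall>\<^sub>F n in sequentially. norm (birkhoff_sum f \<psi> n x / real n - ?I) < r"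
        using elim(1)[rule_format, of m] elim(2)[rule_format, of m] eventually_gt_at_top[of 0]
      proof eventually_elim
        case (elim n)
        have "birkhoff_sum f (\<lambda>x. - \<psi> x) n x = - birkhoff_sum f \<psi> n x"
          by (simp add: birkhoff_sum_def sum_negf)
        then have "birkhoff_sum f \<psi> n x / real n \<le> ?I + 1 / Suc m"
          "birkhoff_sum f \<psi> n x / real n \<ge> ?I - 1 / Suc m"
          using elim by (simp_all add: divide_simps) (simp_all add: algebra_simps)
        then show ?case using m by (simp add: abs_less_iff)
      qed
      then show "\<exists>no. \<forall>n\<ge>no. norm (birkhoff_sum f \<psi> n x / real n - ?I) < r"
        by (simp add: eventually_sequentially)
    qed
  qed
qed

end

section \<open>Itineraries and their entropy\<close>

lemma fekete_subadditive:
  fixes h :: "nat \<Rightarrow> real"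
  assumes sub: "\<And>m n. h (m + n) \<le> h m + h n" and nonneg: "\<And>n. 0 \<le> h n"
  shows "convergent (\<lambda>n. h n / real n)"
proof -
  define L where "L = (INF n\<in>{1..}. h n / real n)"
  have bdd: "bdd_below ((\<lambda>n. h n / real n) ` {1..})"
    by (rule bdd_belowI[of _ 0]) (use nonneg in auto)
  have L: "L \<le> h n / real n" if "n \<ge> 1" for n
    unfolding L_def using that by (intro cINF_lower bdd) auto
  have mult: "h (q * m + r) \<le> real q * h m + h r" for q m r
  proof (induction q)
    case (Suc q)
    then show ?case using sub[of m "q * m + r"] by (simp add: algebra_simps)
  qed simp
  have "(\<lambda>n. h n / real n) \<longlonglongrightarrow> L"
  proof (rule order_tendstoI)
    fix a assume "a < L"
    show "\<forall>\<^sub>F n in sequentially. a < h n / real n"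
      using eventually_ge_at_top[of 1] by eventually_elim (use L \<open>a < L\<close> in force)
  next
    fix a assume "L < a"
    obtain b where b: "L < b" "b < a" using dense[OF \<open>L < a\<close>] by auto
    then obtain m where m: "m \<ge> 1" "h m / real m < b"
      unfolding L_def using cINF_less_iff[OF _ bdd, of b] by auto
    \<comment> \<open>A common bound for the remainders \<open>h (n mod m)\<close>; divided by
      \<open>n\<close> it tends to 0.\<close>
    define C where "C = (\<Sum>r<m. h r)"
    have C: "h r \<le> C" if "r < m" for r
      unfolding C_def using that nonneg by (intro member_le_sum) auto
    have "0 \<le> b" using m nonneg[of m] by (smt (verit) divide_nonneg_nonneg of_nat_0_le_iff)
    have "(\<lambda>n. b + C / real n) \<longlonglongrightarrow> b + 0"
      by (intro tendsto_intros tendsto_divide_0[OF tendsto_const] filterlim_real_at_infinity_sequentially)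
    then have "\<forall>\<^sub>F n in sequentially. b + C / real n < a"
      using b by (intro order_tendstoD) auto
    then show "\<forall>\<^sub>F n in sequentially. h n / real n < a"
      using eventually_ge_at_top[of 1]
    proof eventually_elim
      case (elim n)
      have "h n \<le> real (n div m) * h m + h (n mod m)"
        using mult[of "n div m" m "n mod m"] by simp
      also have "\<dots> \<le> real (n div m) * (real m * b) + C"
        using m by (intro add_mono mult_left_mono C) (auto simp: divide_simps algebra_simps)
      also have "\<dots> \<le> real n * b + C"
      proof -
        have "real (n div m) * real m \<le> real n"
          by (metis of_nat_mult of_nat_le_iff div_times_less_eq_dividend)
        then show ?thesis using mult_right_mono[OF _ \<open>0 \<le> b\<close>] by (simp add: mult.assoc[symmetric])
      qed
      finally have "h n / real n \<le> b + C / real n"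
        using elim by (simp add: divide_simps algebra_simps)
      then show ?case using elim by linarith
    qed
  qed
  then show ?thesis by (auto simp: convergent_def)
qed

section \<open>Words, itineraries and cylinders\<close>

definition words :: "'b set \<Rightarrow> nat \<Rightarrow> 'b list set" where
  "words A n = {w. set w \<subseteq> A \<and> length w = n}"

lemma words_0 [simp]: "words A 0 = {[]}"
  by (auto simp: words_def)

lemma length_words: "w \<in> words A n \<Longrightarrow> length w = n"
  by (simp add: words_def)

lemma finite_words [simp]: "finite A \<Longrightarrow> finite (words A n)"
  unfolding words_def by (rule finite_lists_length_eq)

lemma sum_words_Suc:
  "(\<Sum>w\<in>words A (Suc n). F w) = (\<Sum>s\<in>A. \<Sum>w\<in>words A n. F (s # w))"
proof -
  have "bij_betw (\<lambda>(s, w). s # w) (A \<times> words A n) (words A (Suc n))"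
    by (rule bij_betw_byWitness[where f' = "\<lambda>w. (hd w, tl w)"])
      (auto simp: words_def length_Suc_conv)
  from sum.reindex_bij_betw[OF this, of F, symmetric] show ?thesis
    by (simp add: sum.cartesian_product case_prod_unfold)
qed

lemma sum_words_append:
  "(\<Sum>w\<in>words A (m + n). F w) = (\<Sum>u\<in>words A m. \<Sum>v\<in>words A n. F (u @ v))"
  by (induction m arbitrary: F) (auto simp: sum_words_Suc)

fun itinerary :: "('a \<Rightarrow> 'a) \<Rightarrow> ('a \<Rightarrow> 'b) \<Rightarrow> nat \<Rightarrow> 'a \<Rightarrow> 'b list" where
  "itinerary f c 0 x = []"
| "itinerary f c (Suc n) x = c x # itinerary f c n (f x)"

lemma length_itinerary [simp]: "length (itinerary f c n x) = n"
  by (induction n arbitrary: x) auto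

lemma nth_itinerary [simp]: "i < n \<Longrightarrow> itinerary f c n x ! i = c ((f ^^ i) x)"
  by (induction n arbitrary: x i) (auto simp: nth_Cons funpow_swap1 split: nat.split)

lemma itinerary_add:
  "itinerary f c (m + n) x = itinerary f c m x @ itinerary f c n ((f ^^ m) x)"
  by (induction m arbitrary: x) (auto simp: funpow_swap1)

lemma itinerary_eq_iff:
  "itinerary f c n x = itinerary f c n y \<longleftrightarrow> (\<forall>i<n. c ((f ^^ i) x) = c ((f ^^ i) y))"
  by (simp add: list_eq_iff_nth_eq)

text \<open>A finite partition enters through its labelling, which turns the cells of its joins into
  cylinders of words. Labels with an empty cell are allowed.\<close>

locale labelled_mpt = mpt M f for M :: "'a measure" and f +
  fixes A :: "'b set" and c :: "'a \<Rightarrow> 'b"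
  assumes finite_A: "finite A"
    and label_in: "c x \<in> A"
    and label_sets: "c -` {s} \<in> sets M"
begin

abbreviation itin :: "nat \<Rightarrow> 'a \<Rightarrow> 'b list" where
  "itin \<equiv> itinerary f c"

definition cyl :: "'b list \<Rightarrow> 'a set" where
  "cyl w = {x. itin (length w) x = w}"

definition pr :: "'b list \<Rightarrow> real" where
  "pr w = prob (cyl w)"

lemma card_A_pos: "0 < card A"
  using finite_A label_in by (auto simp: card_gt_0_iff)

lemma cyl_Cons: "cyl (s # w) = c -` {s} \<inter> f -` cyl w"
  by (auto simp: cyl_def)

lemma vimage_sets [measurable (raw)]: "B \<in> sets M \<Longrightarrow> f -` B \<in> sets M"
  using measurable_sets[OF f_measurable, of B] by simp

lemma cyl_sets [measurable]: "cyl w \<in> sets M"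
proof (induction w)
  case Nil
  show ?case using sets.top[of M] by (simp add: cyl_def)
next
  case (Cons s w)
  then show ?case unfolding cyl_Cons by (intro sets.Int label_sets vimage_sets)
qed

lemma itin_words: "itin n x \<in> words A n"
  by (induction n arbitrary: x) (auto simp: words_def label_in)

lemma pr_nonneg: "0 \<le> pr w"
  by (simp add: pr_def)

lemma pr_le_1: "pr w \<le> 1"
  by (simp add: pr_def)

text \<open>Functions of the itinerary become finite combinations of indicators of cylinders;
  measurability and integrals follow without a \<sigma>-algebra on words.\<close>

lemma itin_function: "F (itin n x) = (\<Sum>w\<in>words A n. F w * indicator (cyl w) x)"
  for F :: "'b list \<Rightarrow> real"
proof -
  have "(\<Sum>w\<in>words A n. F w * indicator (cyl w) x) = (\<Sum>w\<in>words A n. if w = itin n x then F w else 0)"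
    by (intro sum.cong) (auto simp: cyl_def words_def indicator_def)
  then show ?thesis using itin_words[of n x] finite_A by (simp add: sum.delta)
qed

lemma itin_measurable [measurable]:
  fixes F :: "'b list \<Rightarrow> real"
  shows "(\<lambda>x. F (itin n x)) \<in> borel_measurable M"
  unfolding itin_function by measurable

lemma itin_bounded:
  fixes F :: "'b list \<Rightarrow> real"
  shows "\<bar>F (itin n x)\<bar> \<le> (\<Sum>w\<in>words A n. \<bar>F w\<bar>)"
  by (rule member_le_sum) (use itin_words finite_A in auto)

lemma integrable_itin:
  fixes F :: "'b list \<Rightarrow> real"
  shows "integrable M (\<lambda>x. F (itin n x))"
  by (rule integrable_bounded[OF itin_measurable itin_bounded])

lemma integral_itin:
  fixes F :: "'b list \<Rightarrow> real"
  shows "(\<integral>x. F (itin n x) \<partial>M) = (\<Sum>w\<in>words A n. pr w * F w)"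
proof -
  have "(\<integral>x. F (itin n x) \<partial>M) = (\<Sum>w\<in>words A n. (\<integral>x. F w * indicator (cyl w) x \<partial>M))"
    unfolding itin_function
    by (intro Bochner_Integration.integral_sum integrable_mult_right integrable_real_indicator)
      (auto simp: emeasure_eq_measure)
  then show ?thesis by (simp add: pr_def mult.commute)
qed

lemma sum_pr: "(\<Sum>w\<in>words A n. pr w) = 1"
  using integral_itin[of "\<lambda>_. 1" n] prob_space by simp

text \<open>The cylinders of \<open>s # w\<close> partition the preimage of the cylinder of
  \<open>w\<close>, and the measure is invariant. This normalises the transitions from right to left
  used below.\<close>

lemma sum_pr_Cons: "(\<Sum>s\<in>A. pr (s # w)) = pr w"
proof -
  have "(\<Sum>s\<in>A. pr (s # w)) = prob (\<Union>s\<in>A. cyl (s # w))"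
    unfolding pr_def
  proof (rule finite_measure_finite_Union[symmetric])
    show "disjoint_family_on (\<lambda>s. cyl (s # w)) A"
      by (auto simp: disjoint_family_on_def cyl_Cons)
  qed (use finite_A in auto)
  also have "(\<Union>s\<in>A. cyl (s # w)) = f -` cyl w"
    using label_in by (auto simp: cyl_Cons)
  also have "prob (f -` cyl w) = pr w"
    using measure_funpow_vimage[of "cyl w" 1] by (simp add: pr_def)
  finally show ?thesis .
qed

lemma AE_pr_pos: "AE x in M. \<forall>n. 0 < pr (itin n x)"
proof (subst AE_all_countable, intro allI)
  fix n
  have "AE x in M. \<forall>w\<in>{w \<in> words A n. pr w = 0}. x \<notin> cyl w"
    using finite_A by (intro AE_finite_allI) (auto simp: pr_def prob_eq_0)
  then show "AE x in M. 0 < pr (itin n x)"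
  proof eventually_elim
    case (elim x)
    have "x \<in> cyl (itin n x)" by (simp add: cyl_def)
    with elim have "pr (itin n x) \<noteq> 0" using itin_words[of n x] by auto
    then show ?case using pr_nonneg[of "itin n x"] by simp
  qed
qed

lemma pr_append_le: "pr (u @ v) \<le> pr u" "pr (u @ v) \<le> pr v"
proof -
  have "cyl (u @ v) \<subseteq> cyl u" "cyl (u @ v) \<subseteq> (f ^^ length u) -` cyl v"
    by (auto simp: cyl_def itinerary_add)
  moreover have "(f ^^ length u) -` cyl v \<in> sets M"
    using measurable_sets[OF funpow_measurable cyl_sets, of "length u" v] by simp
  ultimately have "pr (u @ v) \<le> pr u" "pr (u @ v) \<le> prob ((f ^^ length u) -` cyl v)"
    unfolding pr_def by (auto intro!: finite_measure_mono)
  then show "pr (u @ v) \<le> pr u" "pr (u @ v) \<le> pr v"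
    by (simp_all add: measure_funpow_vimage pr_def)
qed

section \<open>Block entropies and the entropy rate\<close>

definition H :: "nat \<Rightarrow> real" where
  "H n = - (\<Sum>w\<in>words A n. pr w * ln (pr w))"

lemma H_integral: "H n = (\<integral>x. - ln (pr (itin n x)) \<partial>M)"
  using integral_itin[of "\<lambda>w. - ln (pr w)" n] by (simp add: H_def sum_negf)

lemma H_nonneg: "0 \<le> H n"
  unfolding H_def sum_negf[symmetric]
proof (rule sum_nonneg)
  fix w
  show "0 \<le> - (pr w * ln (pr w))"
    using pr_nonneg[of w] pr_le_1[of w]
    by (cases "pr w = 0") (auto intro!: mult_nonneg_nonpos)
qed

text \<open>This is \<open>ln t \<le> t - 1\<close> at \<open>t = q w / pr w\<close>, averaged over
  \<open>pr\<close>. The assumption \<open>pos\<close> excludes words of positive probability with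
  infinite code length, which the total function \<open>ln\<close> would not show.\<close>

lemma gibbs_inequality:
  assumes q: "\<And>w. w \<in> words A n \<Longrightarrow> 0 \<le> q w" and sum: "(\<Sum>w\<in>words A n. q w) \<le> 1"
    and pos: "\<And>w. w \<in> words A n \<Longrightarrow> 0 < pr w \<Longrightarrow> 0 < q w"
  shows "H n \<le> (\<integral>x. - ln (q (itin n x)) \<partial>M)"
proof -
  have "(\<Sum>w\<in>words A n. pr w * ln (q w) - pr w * ln (pr w)) \<le> (\<Sum>w\<in>words A n. q w - pr w)"
  proof (rule sum_mono)
    fix w assume w: "w \<in> words A n"
    show "pr w * ln (q w) - pr w * ln (pr w) \<le> q w - pr w"
    proof (cases "pr w = 0")
      case False
      then have p: "0 < pr w" using pr_nonneg[of w] by simp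
      then have "ln (q w / pr w) \<le> q w / pr w - 1" by (intro ln_le_minus_one) (simp add: pos w)
      then have "pr w * ln (q w / pr w) \<le> pr w * (q w / pr w - 1)" using p by (intro mult_left_mono) auto
      then show ?thesis using p pos[OF w p] by (simp add: ln_div algebra_simps)
    qed (use q w in simp)
  qed
  also have "\<dots> \<le> 0" using sum by (simp add: sum_subtractf sum_pr)
  finally show ?thesis
    using integral_itin[of "\<lambda>w. - ln (q w)" n] by (simp add: H_def sum_subtractf sum_negf)
qed

text \<open>Gibbs' inequality against the product of the laws of the first \<open>m\<close> and the
  last \<open>n\<close> letters.\<close>

lemma H_subadditive: "H (m + n) \<le> H m + H n"
proof -
  let ?q = "\<lambda>w. pr (take m w) * pr (drop m w)"
  have "H (m + n) \<le> (\<integral>x. - ln (?q (itin (m + n) x)) \<partial>M)"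
  proof (rule gibbs_inequality)
    have "(\<Sum>w\<in>words A (m + n). ?q w) = (\<Sum>u\<in>words A m. \<Sum>v\<in>words A n. pr u * pr v)"
      unfolding sum_words_append by (intro sum.cong) (auto simp: length_words)
    then show "(\<Sum>w\<in>words A (m + n). ?q w) \<le> 1"
      by (simp add: sum_distrib_left[symmetric] sum_pr)
    show "0 < ?q w" if "0 < pr w" for w
      using that pr_append_le[of "take m w" "drop m w"] by simp
  qed (simp add: pr_nonneg)
  also have "\<dots> = (\<integral>x. - ln (pr (itin m x)) + - ln (pr (itin n ((f ^^ m) x))) \<partial>M)"
  proof (rule integral_cong_AE)
    show "(\<lambda>x. - ln (?q (itin (m + n) x))) \<in> borel_measurable M"
      by (rule itin_measurable)
    \<comment> \<open>The logarithm of the product splits only for positive factors, hence almost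
      everywhere.\<close>
    show "AE x in M. - ln (?q (itin (m + n) x)) = - ln (pr (itin m x)) + - ln (pr (itin n ((f ^^ m) x)))"
      using AE_pr_pos AE_funpow[OF AE_pr_pos]
    proof eventually_elim
      case (elim x)
      then have "0 < pr (itin m x)" "0 < pr (itin n ((f ^^ m) x))" by auto
      then show ?case by (simp add: itinerary_add ln_mult)
    qed
  qed measurable
  also have "\<dots> = H m + H n"
  proof -
    have "integrable M (\<lambda>x. - ln (pr (itin n ((f ^^ m) x))))"
      using itin_bounded[of "\<lambda>w. - ln (pr w)" n] by (intro integrable_bounded) (measurable, blast)
    then show ?thesis
      using integrable_itin[of "\<lambda>w. - ln (pr w)" m]
        integral_funpow[of "\<lambda>x. - ln (pr (itin n x))" m]
      by (simp add: H_integral)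
  qed
  finally show ?thesis .
qed

definition entropy_rate :: real where
  "entropy_rate = lim (\<lambda>n. H n / real n)"

lemma entropy_rate: "(\<lambda>n. H n / real n) \<longlonglongrightarrow> entropy_rate"
  unfolding entropy_rate_def
  by (rule convergent_LIMSEQ_iff[THEN iffD1], rule fekete_subadditive[OF H_subadditive H_nonneg])

text \<open>The increments of \<open>H\<close> average to the entropy rate, so they cannot all be at
  least \<open>d\<close>.\<close>

lemma H_increment:
  assumes "entropy_rate < d"
  shows "\<exists>k. H (Suc k) - H k < d"
proof (rule ccontr)
  assume "\<not> ?thesis"
  then have "d \<le> H (Suc k) - H k" for k by (simp add: not_less)
  then have inc: "H k + d \<le> H (Suc k)" for k by (simp add: algebra_simps)
  have "real k * d \<le> H k" for k
  proof (induction k)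
    case (Suc k)
    then show ?case using inc[of k] by (simp add: algebra_simps)
  qed (simp add: H_nonneg)
  then have "d \<le> H k / real k" if "k \<ge> 1" for k
    using that by (simp add: divide_simps mult.commute)
  then have "d \<le> entropy_rate" by (intro LIMSEQ_le_const[OF entropy_rate]) blast
  with assms show False by simp
qed

end

section \<open>Partition entropy as the entropy of a labelling\<close>

definition cell_of :: "'a set set \<Rightarrow> 'a \<Rightarrow> 'a set" where
  "cell_of P x = (THE B. B \<in> P \<and> x \<in> B)"

context mpt
begin

context
  fixes P :: "'a set set"
  assumes P: "finite_measurable_partition M P"
begin

lemma cell_of_eq: "B \<in> P \<Longrightarrow> cell_of P x = B \<longleftrightarrow> x \<in> B"
  and cell_of_in: "cell_of P x \<in> P"
proof -
  have "partition_on UNIV P" using P by (simp add: finite_measurable_partition_def)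
  then have "\<exists>!B. B \<in> P \<and> x \<in> B" for x
    unfolding partition_on_def disjoint_def by (metis UNIV_I UnionE disjoint_iff)
  from theI'[OF this] this show "B \<in> P \<Longrightarrow> cell_of P x = B \<longleftrightarrow> x \<in> B" "cell_of P x \<in> P"
    unfolding cell_of_def by blast+
qed

lemma labelled_mpt_cell_of: "labelled_mpt M f P (cell_of P)"
proof
  show "finite P" using P by (simp add: finite_measurable_partition_def)
  show "cell_of P x \<in> P" for x by (rule cell_of_in)
  show "cell_of P -` {s} \<in> sets M" for s
  proof (cases "s \<in> P")
    case True
    then have "cell_of P -` {s} = s" using cell_of_eq by auto
    then show ?thesis using P True by (auto simp: finite_measurable_partition_def)
  next
    case False
    then have "cell_of P -` {s} = {}" using cell_of_in by auto
    then show ?thesis by simp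
  qed
qed

interpretation L: labelled_mpt M f P "cell_of P"
  by (rule labelled_mpt_cell_of)

lemma iterated_partition_eq:
  assumes "n > 0"
  shows "iterated_partition M f P n = L.cyl ` words P n - {{}}"
proof -
  define Q where "Q i = (\<lambda>A. (f ^^ i) -` A) ` P" for i
  have cyl: "L.cyl (L.itin n x) = (\<Inter>i<n. (f ^^ i) -` cell_of P ((f ^^ i) x))" for x
    by (auto simp: L.cyl_def itinerary_eq_iff cell_of_eq[OF cell_of_in])
  \<comment> \<open>The choice functions of a common refinement take the family \<open>Q i\<close>
    as argument, not the index \<open>i\<close>, so times with equal families share one choice. A
    common point \<open>x\<close> determines every chosen cell.\<close>
  have "\<Inter> (g ` Q ` {..<n}) = L.cyl (L.itin n x)"
    if g: "\<And>i. i < n \<Longrightarrow> g (Q i) \<in> Q i" and x: "x \<in> \<Inter> (g ` Q ` {..<n})" for g x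
  proof -
    have "g (Q i) = (f ^^ i) -` cell_of P ((f ^^ i) x)" if i: "i < n" for i
    proof -
      obtain B where B: "B \<in> P" "g (Q i) = (f ^^ i) -` B"
        using g[OF i] unfolding Q_def by blast
      then have "(f ^^ i) x \<in> B" using x i by auto
      then have "cell_of P ((f ^^ i) x) = B" using B cell_of_eq by auto
      then show ?thesis using B by simp
    qed
    then show ?thesis unfolding cyl by auto
  qed
  note A = this
  have "common_refinement (Q ` {..<n}) = L.cyl ` words P n - {{}}"
  proof (intro equalityI subsetI)
    fix B assume "B \<in> common_refinement (Q ` {..<n})"
    then obtain g where g: "\<And>i. i < n \<Longrightarrow> g (Q i) \<in> Q i" "B = \<Inter> (g ` Q ` {..<n})" "B \<noteq> {}"
      unfolding common_refinement by auto
    then obtain x where "x \<in> B" by auto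
    with A[of g x] g have "B = L.cyl (L.itin n x)" by simp
    then show "B \<in> L.cyl ` words P n - {{}}" using g L.itin_words by auto
  next
    fix B assume "B \<in> L.cyl ` words P n - {{}}"
    then obtain w x where w: "w \<in> words P n" "B = L.cyl w" "x \<in> L.cyl w" by auto
    then have B: "B = L.cyl (L.itin n x)" by (auto simp: L.cyl_def length_words)
    define g where "g R = (SOME B. B \<in> R \<and> x \<in> B)" for R
    have g: "g (Q i) \<in> Q i \<and> x \<in> g (Q i)" for i
      unfolding g_def by (rule someI_ex) (use cell_of_in cell_of_eq in \<open>auto simp: Q_def\<close>)
    have "B = \<Inter> (g ` Q ` {..<n})" unfolding B by (rule A[symmetric]) (use g in auto)
    moreover have "x \<in> B" using w by simp
    ultimately show "B \<in> common_refinement (Q ` {..<n})"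
      unfolding common_refinement using g by auto
  qed
  then show ?thesis by (simp add: iterated_partition_def Q_def)
qed

lemma partition_entropy_eq:
  assumes "n > 0"
  shows "partition_entropy M (iterated_partition M f P n) = L.H n"
proof -
  have "(\<Sum>B\<in>L.cyl ` words P n - {{}}. prob B * ln (prob B))
      = (\<Sum>B\<in>L.cyl ` {w \<in> words P n. L.cyl w \<noteq> {}}. prob B * ln (prob B))"
    by (intro sum.cong) auto
  also have "\<dots> = (\<Sum>w\<in>{w \<in> words P n. L.cyl w \<noteq> {}}. prob (L.cyl w) * ln (prob (L.cyl w)))"
  proof (rule sum.reindex_cong[OF _ refl refl], rule inj_onI)
    fix u v assume u: "u \<in> {w \<in> words P n. L.cyl w \<noteq> {}}" "v \<in> {w \<in> words P n. L.cyl w \<noteq> {}}"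
      and eq: "L.cyl u = L.cyl v"
    then obtain x where "x \<in> L.cyl u" "x \<in> L.cyl v" by auto
    then show "u = v" using u by (auto simp: L.cyl_def length_words)
  qed
  \<comment> \<open>Empty cylinders have measure 0 and add nothing.\<close>
  also have "\<dots> = (\<Sum>w\<in>words P n. prob (L.cyl w) * ln (prob (L.cyl w)))"
    using L.finite_A by (intro sum.mono_neutral_left) auto
  finally show ?thesis
    by (simp add: partition_entropy_def iterated_partition_eq[OF assms] L.H_def L.pr_def)
qed

lemma entropy_wrt_partition_eq: "entropy_wrt_partition M f P = L.entropy_rate"
proof -
  have "(\<lambda>n. partition_entropy M (iterated_partition M f P n) / real n) = (\<lambda>n. L.H n / real n)"
  proof
    fix n
    \<comment> \<open>At \<open>n = 0\<close> both sides are quotients by 0, hence 0.\<close>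
    show "partition_entropy M (iterated_partition M f P n) / real n = L.H n / real n"
      by (cases "n = 0") (simp_all add: partition_entropy_eq)
  qed
  then show ?thesis by (simp add: entropy_wrt_partition_def L.entropy_rate_def)
qed

end

end

section \<open>Return times to cylinders\<close>

context mpt
begin

text \<open>A weak form of Kac's lemma, sufficient for Borel--Cantelli: the first \<open>T\<close> preimages of
  the non-returning part are pairwise disjoint.\<close>

lemma prob_no_return:
  assumes [measurable]: "C \<in> sets M"
  shows "prob {x \<in> C. \<forall>k\<in>{1..T}. (f ^^ k) x \<notin> C} \<le> 1 / real (Suc T)"
proof -
  let ?D = "{x \<in> C. \<forall>k\<in>{1..T}. (f ^^ k) x \<notin> C}"
  have "?D = {x \<in> space M. x \<in> C \<and> (\<forall>k\<in>{1..T}. (f ^^ k) x \<notin> C)}" by simp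
  also have "\<dots> \<in> sets M" by measurable
  finally have D: "?D \<in> sets M" .
  have ne: "(f ^^ j) y \<notin> ?D" if "i < j" "j \<le> T" "(f ^^ i) y \<in> ?D" for i j y
  proof
    assume "(f ^^ j) y \<in> ?D"
    moreover have "(f ^^ (j - i)) ((f ^^ i) y) = (f ^^ j) y"
      using that by (metis comp_apply funpow_add le_add_diff_inverse2 less_imp_le)
    moreover have "j - i \<in> {1..T}" using that by auto
    ultimately have "(f ^^ (j - i)) ((f ^^ i) y) \<in> C" "j - i \<in> {1..T}" by simp_all
    with that(3) show False by blast
  qed
  have "disjoint_family_on (\<lambda>i. (f ^^ i) -` ?D) {..T}"
    unfolding disjoint_family_on_def
  proof (intro ballI impI)
    fix i j assume ij: "i \<in> {..T}" "j \<in> {..T}" "i \<noteq> j"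
    then consider "i < j" | "j < i" by linarith
    then show "(f ^^ i) -` ?D \<inter> (f ^^ j) -` ?D = {}"
      using ne[of i j] ne[of j i] ij by cases blast+
  qed
  moreover have "(f ^^ i) -` ?D \<in> sets M" for i
    using measurable_sets[OF funpow_measurable D, of i] by simp
  ultimately have "(\<Sum>i\<le>T. prob ((f ^^ i) -` ?D)) = prob (\<Union>i\<le>T. (f ^^ i) -` ?D)"
    by (intro finite_measure_finite_Union[symmetric]) auto
  then have "(\<Sum>i\<le>T. prob ?D) \<le> 1"
    unfolding measure_funpow_vimage[OF D] using prob_le_1[of "\<Union>i\<le>T. (f ^^ i) -` ?D"] by (rule ord_eq_le_trans)
  then have "real (Suc T) * prob ?D \<le> 1" by simp
  then show ?thesis by (simp add: field_simps)
qed

end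

section \<open>Markov approximations and their code lengths\<close>

context labelled_mpt
begin

text \<open>The \<open>k\<close>-step Markov approximation of the law of the itinerary, with transitions running
  from right to left. Since \<open>x / 0 = 0\<close>, a transition out of a null word has weight \<open>0\<close>.\<close>

fun markov_weight :: "nat \<Rightarrow> 'b list \<Rightarrow> real" where
  "markov_weight k [] = 1"
| "markov_weight k (s # w) =
     (if length w < k then 1 / card A else pr (s # take k w) / pr (take k w)) * markov_weight k w"

lemma markov_weight_nonneg: "0 \<le> markov_weight k w"
  by (induction w) (auto simp: pr_nonneg)

text \<open>Summed over the new leftmost letter, the transition weights give 1, or 0 when the word
  conditioned on is null.\<close>

lemma sum_markov_weight: "(\<Sum>w\<in>words A n. markov_weight k w) \<le> 1"
proof (induction n)
  case (Suc n)
  have "(\<Sum>w\<in>words A (Suc n). markov_weight k w) =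
      (\<Sum>w\<in>words A n. \<Sum>s\<in>A. markov_weight k (s # w))"
    unfolding sum_words_Suc by (rule sum.swap)
  also have "\<dots> \<le> (\<Sum>w\<in>words A n. markov_weight k w)"
  proof (rule sum_mono)
    fix w assume "w \<in> words A n"
    have "(\<Sum>s\<in>A. if length w < k then 1 / card A else pr (s # take k w) / pr (take k w)) \<le> 1"
      using card_A_pos sum_divide_distrib[of "\<lambda>s. pr (s # take k w)" A "pr (take k w)", symmetric]
      by (cases "length w < k") (simp_all add: sum_pr_Cons)
    then have "(\<Sum>s\<in>A. if length w < k then 1 / card A else pr (s # take k w) / pr (take k w)) *
        markov_weight k w \<le> 1 * markov_weight k w"
      using markov_weight_nonneg by (rule mult_right_mono)
    then show "(\<Sum>s\<in>A. markov_weight k (s # w)) \<le> markov_weight k w"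
      by (simp only: markov_weight.simps sum_distrib_right mult_1)
  qed
  finally show ?case using Suc by linarith
qed simp

text \<open>For almost every \<open>x\<close>, this is minus the logarithm of the conditional
  probability of the first letter given the next \<open>k\<close> letters.\<close>

definition info :: "nat \<Rightarrow> 'a \<Rightarrow> real" where
  "info k x = ln (pr (itin k (f x))) - ln (pr (itin (Suc k) x))"

lemma take_itin: "j \<le> n \<Longrightarrow> take j (itin n x) = itin j x"
  by (rule nth_equalityI) auto

lemma markov_weight_itin_short: "j \<le> k \<Longrightarrow> markov_weight k (itin j x) = (1 / card A) ^ j"
  by (induction j arbitrary: x) auto

text \<open>Each transition contributes one term of the Birkhoff sum. The last \<open>k\<close>
  letters have no full context and are weighted uniformly, which costs \<open>ln (card A)\<close>
  each.\<close>

lemma markov_weight_itin: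
  assumes "\<And>m n. 0 < pr (itin n ((f ^^ m) x))"
  shows "0 < markov_weight k (itin (n + k) x) \<and>
    - ln (markov_weight k (itin (n + k) x)) = birkhoff_sum f (info k) n x + real k * ln (card A)"
  using assms
proof (induction n arbitrary: x)
  case 0
  show ?case using card_A_pos
    by (simp add: markov_weight_itin_short ln_div ln_realpow power_one_over)
next
  case (Suc n)
  have fx: "0 < pr (itin n ((f ^^ m) (f x)))" for m n
    using Suc.prems[of n "Suc m"] by (simp add: funpow_swap1)
  have p: "0 < pr (itin (Suc k) x)" "0 < pr (itin k (f x))"
    using Suc.prems[of "Suc k" 0] fx[of k 0] by (simp_all del: itinerary.simps)
  have eq: "markov_weight k (itin (Suc n + k) x) =
      pr (itin (Suc k) x) / pr (itin k (f x)) * markov_weight k (itin (n + k) (f x))"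
    by (simp add: take_itin)
  show ?case
    unfolding eq using p Suc.IH[OF fx]
    by (simp add: ln_mult ln_div birkhoff_sum_Suc info_def del: itinerary.simps(2))
qed

lemma info_measurable [measurable]: "info k \<in> borel_measurable M"
  using itin_measurable[of "\<lambda>w. ln (pr w)" k] itin_measurable[of "\<lambda>w. ln (pr w)" "Suc k"]
  unfolding info_def[abs_def] by measurable

lemma info_bounded: "\<exists>B. \<forall>x. \<bar>info k x\<bar> \<le> B"
proof -
  let ?B = "\<lambda>k. \<Sum>w\<in>words A k. \<bar>ln (pr w)\<bar>"
  have "\<bar>info k x\<bar> \<le> ?B k + ?B (Suc k)" for x
    using itin_bounded[of "\<lambda>w. ln (pr w)" k "f x"] itin_bounded[of "\<lambda>w. ln (pr w)" "Suc k" x]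
    unfolding info_def by linarith
  then show ?thesis by blast
qed

lemma integral_info: "(\<integral>x. info k x \<partial>M) = H (Suc k) - H k"
proof -
  have "integrable M (\<lambda>x. ln (pr (itin k (f x))))"
    using itin_bounded[of "\<lambda>w. ln (pr w)" k] by (intro integrable_bounded) (measurable, blast)
  moreover have "integrable M (\<lambda>x. ln (pr (itin (Suc k) x)))" by (rule integrable_itin)
  ultimately have "(\<integral>x. info k x \<partial>M) =
      (\<integral>x. ln (pr (itin k (f x))) \<partial>M) - (\<integral>x. ln (pr (itin (Suc k) x)) \<partial>M)"
    unfolding info_def by (rule Bochner_Integration.integral_diff)
  then show ?thesis
    using integral_funpow[of "\<lambda>x. ln (pr (itin k x))" 1] by (simp add: H_integral del: itinerary.simps)
qed

text \<open>A cylinder \<open>w\<close> is given the waiting time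
  \<open>exp (\<delta> * n) / q w\<close>, so that its late points have measure at most
  \<open>q w * exp (- \<delta> * n)\<close>. Summed over \<open>w\<close>, this is at most
  \<open>exp (- \<delta> * n)\<close> and summable in \<open>n\<close>.\<close>

lemma eventually_return:
  assumes q: "\<And>w. 0 \<le> q w" "\<And>n. (\<Sum>w\<in>words A n. q w) \<le> 1" and "\<delta> > 0"
  shows "AE x in M. \<forall>\<^sub>F n in sequentially. 0 < q (itin n x) \<longrightarrow>
    (\<exists>t\<ge>1. real t \<le> exp (\<delta> * real n) / q (itin n x) \<and> itin n ((f ^^ t) x) = itin n x)"
proof -
  define T where "T n w = nat \<lfloor>exp (\<delta> * real n) / q w\<rfloor>" for n w
  define B where "B n w = {x \<in> cyl w. \<forall>t\<in>{1..T n w}. (f ^^ t) x \<notin> cyl w}" for n w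
  define W where "W n = {w \<in> words A n. 0 < q w}" for n
  have fin: "finite (W n)" for n using finite_A by (simp add: W_def)
  have Bm [measurable]: "B n w \<in> sets M" for n w
  proof -
    have "B n w = {x \<in> space M. x \<in> cyl w \<and> (\<forall>t\<in>{1..T n w}. (f ^^ t) x \<notin> cyl w)}"
      by (simp add: B_def)
    also have "\<dots> \<in> sets M" by measurable
    finally show ?thesis .
  qed
  have B: "prob (B n w) \<le> q w * exp (- \<delta>) ^ n" if "w \<in> W n" for n w
  proof -
    have q: "0 < q w" using that by (simp add: W_def)
    have "exp (\<delta> * real n) / q w \<le> real (Suc (T n w))" unfolding T_def by linarith
    then have "1 / real (Suc (T n w)) \<le> 1 / (exp (\<delta> * real n) / q w)"
      using q by (intro divide_left_mono) auto
    also have "\<dots> = q w * exp (- \<delta>) ^ n"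
      by (simp add: exp_of_nat2_mult exp_minus power_inverse divide_inverse)
    finally show ?thesis
      using prob_no_return[OF cyl_sets, of w "T n w"] by (simp add: B_def)
  qed
  have "prob (\<Union>w\<in>W n. B n w) \<le> exp (- \<delta>) ^ n" for n
  proof -
    have "prob (\<Union>w\<in>W n. B n w) \<le> (\<Sum>w\<in>W n. prob (B n w))"
      using fin Bm by (intro finite_measure_subadditive_finite) auto
    also have "\<dots> \<le> (\<Sum>w\<in>W n. q w * exp (- \<delta>) ^ n)" by (intro sum_mono B)
    also have "\<dots> \<le> (\<Sum>w\<in>words A n. q w * exp (- \<delta>) ^ n)"
      by (rule sum_mono2) (auto simp: W_def finite_A q(1))
    also have "\<dots> \<le> 1 * exp (- \<delta>) ^ n"
      unfolding sum_distrib_right[symmetric] by (rule mult_right_mono[OF q(2)]) simp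
    finally show ?thesis by simp
  qed
  then have le: "norm (prob (\<Union>w\<in>W n. B n w)) \<le> exp (- \<delta>) ^ n" for n
    by simp
  have "norm (exp (- \<delta>)) < 1" using \<open>\<delta> > 0\<close> by simp
  then have "summable (\<lambda>n. exp (- \<delta>) ^ n)" by (rule summable_geometric)
  then have "summable (\<lambda>n. prob (\<Union>w\<in>W n. B n w))"
    by (rule summable_comparison_test'[of _ 0]) (rule le)
  then have "AE x in M. \<forall>\<^sub>F n in sequentially. x \<in> space M - (\<Union>w\<in>W n. B n w)"
    using fin Bm by (intro borel_cantelli_AE1) (auto simp: emeasure_eq_measure)
  then show ?thesis
  proof eventually_elim
    case (elim x)
    from elim show ?case
    proof eventually_elim
      case (elim n)
      show ?case
      proof
        assume pos: "0 < q (itin n x)"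
        then have "itin n x \<in> W n" using itin_words by (simp add: W_def)
        then have "x \<notin> B n (itin n x)" using elim by auto
        then obtain t where t: "t \<in> {1..T n (itin n x)}" "itin n ((f ^^ t) x) = itin n x"
          by (auto simp: B_def cyl_def)
        then have "real t \<le> exp (\<delta> * real n) / q (itin n x)"
          using pos unfolding T_def by (auto simp: le_nat_iff le_floor_iff)
        then show "\<exists>t\<ge>1. real t \<le> exp (\<delta> * real n) / q (itin n x) \<and> itin n ((f ^^ t) x) = itin n x"
          using t by auto
      qed
    qed
  qed
qed

end

locale ergodic_labelled_mpt = labelled_mpt M f A c + ergodic_mpt M f
  for M :: "'a measure" and f and A :: "'b set" and c
begin

theorem return_time_upper:
  assumes "entropy_rate < d"
  shows "AE x in M. \<forall>\<^sub>F n in sequentially.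
    \<exists>t\<ge>1. real t \<le> exp (d * real n) \<and> itin n ((f ^^ t) x) = itin n x"
proof -
  obtain d' where d': "entropy_rate < d'" "d' < d" using dense[OF assms] by auto
  \<comment> \<open>One \<delta> pays for the factor \<open>exp (\<delta> * n)\<close> in
    \<open>eventually_return\<close>, the other for the last \<open>k\<close> letters.\<close>
  define \<delta> where "\<delta> = (d - d') / 2"
  have \<delta>: "0 < \<delta>" using d' by (simp add: \<delta>_def)
  obtain k where k: "H (Suc k) - H k < d'" using H_increment[OF d'(1)] by auto
  obtain B where B: "\<And>x. \<bar>info k x\<bar> \<le> B" using info_bounded by blast
  have "AE x in M. \<forall>\<^sub>F n in sequentially. birkhoff_sum f (info k) n x \<le> real n * d'"
    by (rule birkhoff_upper[OF info_measurable B]) (simp add: integral_info k)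
  moreover note AE_funpow[OF AE_pr_pos]
    eventually_return[of "markov_weight k", OF markov_weight_nonneg sum_markov_weight \<delta>]
  ultimately show ?thesis
  proof eventually_elim
    case (elim x)
    have "\<forall>\<^sub>F n in sequentially. real k * (ln (card A) + \<delta> - d) / \<delta> \<le> real n"
      using filterlim_real_sequentially by (auto simp: filterlim_at_top)
    \<comment> \<open>A word of length \<open>n + k\<close> has \<open>n\<close> Markov transitions,
      so the estimates run along the shifted index.\<close>
    moreover have "\<forall>\<^sub>F n in sequentially. 0 < markov_weight k (itin (n + k) x) \<longrightarrow>
      (\<exists>t\<ge>1. real t \<le> exp (\<delta> * real (n + k)) / markov_weight k (itin (n + k) x) \<and>
         itin (n + k) ((f ^^ t) x) = itin (n + k) x)"
      using elim(3) by (rule eventually_sequentially_seg[THEN iffD2])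
    ultimately have "\<forall>\<^sub>F n in sequentially.
      \<exists>t\<ge>1. real t \<le> exp (d * real (n + k)) \<and> itin (n + k) ((f ^^ t) x) = itin (n + k) x"
      using elim(1)
    proof eventually_elim
      case (elim n)
      have pos: "0 < markov_weight k (itin (n + k) x)"
        and ln: "- ln (markov_weight k (itin (n + k) x))
          = birkhoff_sum f (info k) n x + real k * ln (card A)"
        using markov_weight_itin[where x = x and k = k and n = n] \<open>\<forall>n m. 0 < pr (itin m ((f ^^ n) x))\<close> by auto
      have "real k * (ln (card A) + \<delta> - d) \<le> real n * \<delta>"
        using elim(1) \<delta> by (simp add: divide_simps)
      moreover have "real n * d = real n * d' + 2 * (real n * \<delta>)"
        by (simp add: \<delta>_def field_simps)
      ultimately have "\<delta> * real (n + k) - ln (markov_weight k (itin (n + k) x)) \<le> d * real (n + k)"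
        using elim(3) ln by (simp add: algebra_simps)
      then have "exp (\<delta> * real (n + k)) / markov_weight k (itin (n + k) x) \<le> exp (d * real (n + k))"
        using pos exp_diff[of "\<delta> * real (n + k)" "ln (markov_weight k (itin (n + k) x))"]
        by (metis exp_le_cancel_iff exp_ln)
      moreover obtain t where "t \<ge> 1" "itin (n + k) ((f ^^ t) x) = itin (n + k) x"
        "real t \<le> exp (\<delta> * real (n + k)) / markov_weight k (itin (n + k) x)"
        using elim(2) pos by blast
      ultimately show ?case by (intro exI[of _ t]) linarith
    qed
    then show ?case by (rule eventually_sequentially_seg[THEN iffD1])
  qed
qed

end

section \<open>Coding by nearby copies\<close>

text \<open>Regularity of finite Borel measures, by induction over the \<sigma>-algebra generated by
  the closed sets. Approximating from both sides at once makes the property stable under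
  complements, which exchange the two sides.\<close>

lemma closed_open_approx:
  fixes A :: "'a::metric_space set"
  assumes "finite_measure M" and sets_M: "sets M = sets borel" and A: "A \<in> sets M" and e: "e > 0"
  shows "\<exists>K U. closed K \<and> open U \<and> K \<subseteq> A \<and> A \<subseteq> U \<and> measure M (U - K) < e"
proof -
  interpret finite_measure M by fact
  have sets: "closed K \<Longrightarrow> open U \<Longrightarrow> U - K \<in> sets M" for K U
    using sets_M by auto
  have "sets (borel :: 'a measure) = sigma_sets UNIV (Collect closed)"
    unfolding borel_eq_closed by (rule sets_measure_of) simp
  then have "A \<in> sigma_sets UNIV (Collect closed)"
    using A sets_M by simp
  then show ?thesis using e
  proof (induction A arbitrary: e rule: sigma_sets.induct)
    case (Basic A)
    then have A: "closed A" by simp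
    show ?case
    proof (cases "A = {}")
      case True
      then show ?thesis using Basic by (intro exI[of _ "{}"]) auto
    next
      case False
      \<comment> \<open>A closed set is the intersection of these decreasing open
        neighbourhoods.\<close>
      let ?U = "\<lambda>n. {x. infdist x A < 1 / real (Suc n)}"
      have U: "open (?U n)" for n
        by (intro open_Collect_less continuous_intros)
      have "(\<Inter>n. ?U n) \<subseteq> A"
      proof
        fix x assume x: "x \<in> (\<Inter>n. ?U n)"
        have "infdist x A = 0"
        proof (rule ccontr)
          assume "infdist x A \<noteq> 0"
          then have "infdist x A > 0" using infdist_nonneg[of x A] by simp
          then obtain n where "1 / real (Suc n) < infdist x A" using nat_approx_posE by blast
          moreover have "x \<in> ?U n" using x by (rule INT_D) simp
          ultimately show False by simp
        qed
        then show "x \<in> A" using in_closed_iff_infdist_zero[OF A False] by simp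
      qed
      then have "(\<Inter>n. ?U n - A) = {}" by auto
      moreover have "decseq (\<lambda>n. ?U n - A)"
      proof (rule decseq_SucI)
        fix n
        have "1 / real (Suc (Suc n)) \<le> 1 / real (Suc n)" by (simp add: divide_simps)
        then show "?U (Suc n) - A \<subseteq> ?U n - A" by auto
      qed
      moreover have "range (\<lambda>n. ?U n - A) \<subseteq> sets M" using sets[OF A U] by blast
      ultimately have "(\<lambda>n. measure M (?U n - A)) \<longlonglongrightarrow> 0"
        using finite_Lim_measure_decseq[of "\<lambda>n. ?U n - A"] by (simp only: measure_empty)
      then have ev: "\<forall>\<^sub>F n in sequentially. measure M (?U n - A) < e"
        using Basic(2) by (rule order_tendstoD(2))
      obtain n where n: "measure M (?U n - A) < e"
        using eventually_happens'[OF sequentially_bot ev] ..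
      have "A \<subseteq> ?U n"
      proof
        fix x assume "x \<in> A"
        then have "infdist x A = 0" by simp
        then show "x \<in> ?U n" by simp
      qed
      then show ?thesis using A U[of n] n by (intro exI[of _ A] exI[of _ "?U n"] conjI order_refl)
    qed
  next
    case Empty
    then show ?case by (intro exI[of _ "{}"]) auto
  next
    case (Compl A)
    obtain K U where KU: "closed K" "open U" "K \<subseteq> A" "A \<subseteq> U" "measure M (U - K) < e"
      using Compl.IH[OF Compl.prems] by (elim exE conjE)
    have "- K - - U = U - K" by auto
    then show ?case using KU by (intro exI[of _ "- U"] exI[of _ "- K"]) auto
  next
    case (Union A)
    \<comment> \<open>These errors sum to \<open>e / 2\<close>; the other half is left for keeping
      only finitely many of the closed sets.\<close>
    have "\<exists>K U. closed K \<and> open U \<and> K \<subseteq> A i \<and> A i \<subseteq> U \<and> measure M (U - K) < e / 4 * (1 / 2) ^ i" for i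
      using Union.prems by (intro Union.IH) auto
    then obtain K U where KU: "\<And>i. closed (K i)" "\<And>i. open (U i)" "\<And>i. K i \<subseteq> A i"
      "\<And>i. A i \<subseteq> U i" "\<And>i. measure M (U i - K i) < e / 4 * (1 / 2) ^ i"
      by metis
    \<comment> \<open>A countable union of closed sets need not be closed, so it is truncated at
      \<open>N\<close>; by continuity from above some \<open>N\<close> is good enough.\<close>
    let ?V = "\<lambda>N. (\<Union>i. U i) - (\<Union>i<N. K i)"
    have sums: "(\<lambda>i. e / 4 * (1 / 2) ^ i) sums (e / 2)"
      using sums_mult[OF geometric_sums[of "1 / 2 :: real"], of "e / 4"] by simp
    have summ: "summable (\<lambda>i. measure M (U i - K i))"
      by (rule summable_comparison_test'[OF sums_summable[OF sums], of 0]) (use KU in \<open>auto intro: less_imp_le\<close>)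
    have UK: "U i - K i \<in> sets M" for i using sets KU(1,2) by blast
    have "measure M ((\<Union>i. U i) - (\<Union>i. K i)) \<le> measure M (\<Union>i. U i - K i)"
      using UK by (intro finite_measure_mono sets.countable_UN) auto
    also have "\<dots> \<le> (\<Sum>i. measure M (U i - K i))"
      using UK summ by (intro finite_measure_subadditive_countably) auto
    also have "\<dots> \<le> e / 2"
      unfolding sums_unique[OF sums]
      by (intro suminf_le summ sums_summable[OF sums] less_imp_le KU)
    also have "\<dots> < e" using Union.prems by simp
    finally have lt: "measure M ((\<Union>i. U i) - (\<Union>i. K i)) < e" .
    have eq: "(\<Union>i. U i) - (\<Union>i. K i) = (\<Inter>N. ?V N)"
    proof (intro equalityI subsetI)
      fix x assume x: "x \<in> (\<Inter>N. ?V N)"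
      have "x \<notin> K i" for i
      proof -
        have "x \<in> ?V (Suc i)" using x by (rule INT_D) simp
        then show ?thesis by auto
      qed
      moreover have "x \<in> (\<Union>i. U i)" using INT_D[OF x, of 0] by auto
      ultimately show "x \<in> (\<Union>i. U i) - (\<Union>i. K i)" by auto
    qed auto
    have "measure M (\<Inter>N. ?V N) < e" using lt unfolding eq .
    moreover have "(\<lambda>N. measure M (?V N)) \<longlonglongrightarrow> measure M (\<Inter>N. ?V N)"
    proof (rule finite_Lim_measure_decseq)
      have "open (\<Union>i. U i)" "closed (\<Union>i<N. K i)" for N using KU(1,2) by auto
      then have "?V N \<in> sets M" for N using sets by blast
      then show "range ?V \<subseteq> sets M" by blast
      show "decseq ?V" by (rule decseq_SucI) (simp add: lessThan_Suc, blast)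
    qed
    ultimately have ev: "\<forall>\<^sub>F N in sequentially. measure M (?V N) < e"
      by (intro order_tendstoD(2))
    obtain N where "measure M (?V N) < e"
      using eventually_happens'[OF sequentially_bot ev] ..
    moreover have "closed (\<Union>i<N. K i)" "open (\<Union>i. U i)" using KU(1,2) by auto
    moreover have "(\<Union>i<N. K i) \<subseteq> (\<Union>i. A i)" "(\<Union>i. A i) \<subseteq> (\<Union>i. U i)"
      using KU(3,4) by blast+
    ultimately show ?case
      by (intro exI[of _ "\<Union>i<N. K i"] exI[of _ "\<Union>i. U i"] conjI)
  qed
qed

section \<open>A subprobability on words that copies from the right\<close>

locale copy_code =
  fixes S :: "'b set" and \<tau> :: "'b \<Rightarrow> 'b" and \<gamma> :: real and n T :: nat
  assumes finite_S: "finite S" and S_ne: "S \<noteq> {}"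
    and \<gamma>: "0 < \<gamma>" "\<gamma> < 1" and n_pos: "0 < n" and T_pos: "0 < T"
begin

lemma card_S: "1 \<le> card S"
  using finite_S S_ne by (simp add: Suc_leI card_gt_0_iff)

text \<open>Each of the first \<open>m\<close> letters is predicted by \<tau> from the letter
  \<open>k\<close> places further right; \<gamma> is the probability reserved for errors, spread
  evenly over \<open>S\<close>. For \<open>0 < k < m\<close> some sources lie in the block itself,
  but they are to the right and so already decoded.\<close>

definition copy_weight :: "nat \<Rightarrow> nat \<Rightarrow> 'b list \<Rightarrow> real" where
  "copy_weight m k w = (\<Prod>i<m. if w ! i = \<tau> (w ! (i + k)) then 1 - \<gamma> else \<gamma> / card S)"

lemma copy_weight_nonneg: "0 \<le> copy_weight m k w"
  unfolding copy_weight_def using \<gamma> by (intro prod_nonneg) auto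

lemma copy_weight_Cons:
  "copy_weight (Suc m) (Suc k) (s # w) =
    (if s = \<tau> (w ! k) then 1 - \<gamma> else \<gamma> / card S) * copy_weight m (Suc k) w"
  by (simp add: copy_weight_def prod.lessThan_Suc_shift del: prod.lessThan_Suc)

text \<open>The prediction of the leftmost letter depends only on letters to its right, the distance
  being positive. Summing over that letter first leaves a factor at most 1, also when \<tau>
  predicts a letter outside \<open>S\<close>.\<close>

lemma sum_copy_weight: "(\<Sum>u\<in>words S m. copy_weight m (Suc k) (u @ v)) \<le> 1"
proof (induction m)
  case (Suc m)
  have factor: "(\<Sum>s\<in>S. if s = t then 1 - \<gamma> else \<gamma> / card S) \<le> 1" for t
  proof -
    have "(\<Sum>s\<in>S. if s = t then 1 - \<gamma> else \<gamma> / card S) \<le>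
        (\<Sum>s\<in>S. (if s = t then 1 - \<gamma> else 0) + \<gamma> / card S)"
      using \<gamma> by (intro sum_mono) auto
    also have "\<dots> = (if t \<in> S then 1 - \<gamma> else 0) + \<gamma>"
      using finite_S card_S S_ne by (simp add: sum.distrib sum.delta)
    finally show ?thesis using \<gamma> by (auto split: if_splits)
  qed
  have "(\<Sum>u\<in>words S (Suc m). copy_weight (Suc m) (Suc k) (u @ v)) =
     (\<Sum>u\<in>words S m. \<Sum>s\<in>S. (if s = \<tau> ((u @ v) ! k) then 1 - \<gamma> else \<gamma> / card S) *
        copy_weight m (Suc k) (u @ v))"
    unfolding sum_words_Suc by (subst sum.swap) (simp add: copy_weight_Cons)
  also have "\<dots> \<le> (\<Sum>u\<in>words S m. 1 * copy_weight m (Suc k) (u @ v))"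
    unfolding sum_distrib_right[symmetric]
    by (intro sum_mono mult_right_mono factor copy_weight_nonneg)
  finally show ?case using Suc by simp
qed (simp add: copy_weight_def)

text \<open>A mixture over all parses of a word, from left to right, into single letters and blocks of
  length \<open>n\<close>; a block is predicted from the text \<open>k \<le> T\<close> places further right.\<close>

function omega :: "'b list \<Rightarrow> real" where
  "omega [] = 1"
| "omega (s # w) = 1 / (2 * card S) * omega w +
     (if n \<le> length (s # w)
      then 1 / (2 * T) * (\<Sum>k<T. copy_weight n (Suc k) (s # w)) * omega (drop n (s # w)) else 0)"
  by pat_completeness auto
termination by (relation "Wellfounded.measure length") (use n_pos in auto)

lemma omega_nonneg: "0 \<le> omega w"
  by (induction w rule: omega.induct)
    (auto intro!: add_nonneg_nonneg mult_nonneg_nonneg divide_nonneg_nonneg sum_nonneg copy_weight_nonneg)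

lemma sum_omega: "(\<Sum>w\<in>words S L. omega w) \<le> 1"
proof (induction L rule: less_induct)
  case (less L)
  show ?case
  proof (cases L)
    case (Suc L')
    let ?raw = "\<lambda>w. 1 / (2 * card S) * omega (tl w)"
    let ?copy = "\<lambda>w. 1 / (2 * T) * (\<Sum>k<T. copy_weight n (Suc k) w) * omega (drop n w)"
    have "(\<Sum>w\<in>words S L. omega w) = (\<Sum>w\<in>words S L. ?raw w + (if n \<le> L then ?copy w else 0))"
    proof (rule sum.cong[OF refl])
      fix w assume "w \<in> words S L"
      then show "omega w = ?raw w + (if n \<le> L then ?copy w else 0)"
        using Suc by (cases w) (auto simp: words_def)
    qed
    also have "\<dots> = (\<Sum>w\<in>words S L. ?raw w) + (\<Sum>w\<in>words S L. if n \<le> L then ?copy w else 0)"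
      by (rule sum.distrib)
    also have "\<dots> \<le> 1 / 2 + 1 / 2"
    proof (rule add_mono)
      have "(\<Sum>w\<in>words S L. ?raw w) = 1 / 2 * (\<Sum>w\<in>words S L'. omega w)"
        using card_S by (simp add: Suc sum_words_Suc sum_divide_distrib[symmetric])
      then show "(\<Sum>w\<in>words S L. ?raw w) \<le> 1 / 2" using less.IH[of L'] Suc by simp
      show "(\<Sum>w\<in>words S L. if n \<le> L then ?copy w else 0) \<le> 1 / 2"
      proof (cases "n \<le> L")
        case True
        then obtain m where L: "L = n + m" using le_Suc_ex by blast
        have "(\<Sum>w\<in>words S L. ?copy w) = (\<Sum>u\<in>words S n. \<Sum>v\<in>words S m.
            1 / (2 * T) * (\<Sum>k<T. copy_weight n (Suc k) (u @ v)) * omega v)"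
          unfolding L sum_words_append by (intro sum.cong refl) (simp add: length_words)
        \<comment> \<open>The suffix must be fixed while the block is summed, since the block may
          copy from it.\<close>
        also have "\<dots> = (\<Sum>v\<in>words S m. \<Sum>u\<in>words S n.
            1 / (2 * T) * (\<Sum>k<T. copy_weight n (Suc k) (u @ v)) * omega v)"
          by (rule sum.swap)
        also have "\<dots> = (\<Sum>v\<in>words S m.
            1 / (2 * T) * (\<Sum>k<T. \<Sum>u\<in>words S n. copy_weight n (Suc k) (u @ v)) * omega v)"
          by (subst sum.swap) (simp only: sum_distrib_left sum_distrib_right)
        also have "\<dots> \<le> (\<Sum>v\<in>words S m. 1 / (2 * T) * (\<Sum>k<T. 1) * omega v)"
          by (intro sum_mono mult_right_mono mult_left_mono sum_copy_weight omega_nonneg) simp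
        also have "\<dots> = 1 / 2 * (\<Sum>v\<in>words S m. omega v)"
          using T_pos by (simp add: sum_divide_distrib)
        also have "\<dots> \<le> 1 / 2" using less.IH[of m] L n_pos by simp
        finally show ?thesis using True by simp
      qed simp
    qed
    finally show ?thesis by simp
  qed simp
qed

text \<open>Charging the factor \<open>1 - \<gamma>\<close> at wrong predictions too only lowers the
  product, and makes the bound depend on the number of errors alone.\<close>

lemma copy_weight_lower:
  "exp (real m * ln (1 - \<gamma>) - ln (card S / \<gamma>) * real (card {i. i < m \<and> w ! i \<noteq> \<tau> (w ! (i + k))}))
    \<le> copy_weight m k w"
proof -
  let ?P = "\<lambda>i. w ! i \<noteq> \<tau> (w ! (i + k))"
  let ?r = "\<gamma> / card S"
  have r: "0 < ?r" using \<gamma> card_S by simp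
  have "ln (card S / \<gamma>) = - ln ?r" using \<gamma> card_S by (simp add: ln_div)
  then have "exp (real m * ln (1 - \<gamma>) - ln (card S / \<gamma>) * real (card {i. i < m \<and> ?P i})) =
      (1 - \<gamma>) ^ m * ?r ^ card {i. i < m \<and> ?P i}"
    using \<gamma> r by (simp add: exp_add exp_of_nat_mult exp_of_nat2_mult)
  also have "\<dots> = (\<Prod>i<m. (1 - \<gamma>) * (if ?P i then ?r else 1))"
  proof -
    have "(\<Prod>i<m. if ?P i then ?r else 1) = (\<Prod>i\<in>{i \<in> {..<m}. ?P i}. ?r)"
      by (rule prod.inter_filter[symmetric]) simp
    then show ?thesis by (simp add: prod.distrib)
  qed
  also have "\<dots> \<le> copy_weight m k w"
    unfolding copy_weight_def
  proof (rule prod_mono, intro conjI)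
    fix i
    show "0 \<le> (1 - \<gamma>) * (if ?P i then ?r else 1)" using \<gamma> r by auto
    have "(1 - \<gamma>) * ?r \<le> ?r" using \<gamma> r by (intro mult_left_le_one_le) auto
    then show "(1 - \<gamma>) * (if ?P i then ?r else 1) \<le> (if w ! i = \<tau> (w ! (i + k)) then 1 - \<gamma> else ?r)"
      by auto
  qed
  finally show ?thesis .
qed

definition letter_cost :: real where "letter_cost = ln (2 * card S)"

definition error_cost :: real where "error_cost = ln (card S / \<gamma>)"

text \<open>Cost per letter of copying: the choice of the distance is shared by the \<open>n\<close>
  letters of a block, and \<alpha> is the density of errors not explained by visits outside
  \<open>K\<close>.\<close>

definition base_cost :: "real \<Rightarrow> real" where
  "base_cost \<alpha> = ln (2 * T) / n - ln (1 - \<gamma>) + \<alpha> * error_cost"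

text \<open>A bound for the code length of one parse. The term with \<open>min\<close> pays for the
  last \<open>n + T\<close> letters, whose sources could lie beyond the end of the word; visits
  outside \<open>D\<close> are paid as single letters, visits outside \<open>K\<close> as wrong
  predictions.\<close>

definition cost :: "('a \<Rightarrow> 'a) \<Rightarrow> 'a set \<Rightarrow> 'a set \<Rightarrow> real \<Rightarrow> nat \<Rightarrow> 'a \<Rightarrow> real" where
  "cost f D K \<alpha> L y = letter_cost * real (min L (n + T)) + base_cost \<alpha> * real L
    + letter_cost * birkhoff_sum f (indicator (- D)) L y
    + error_cost * birkhoff_sum f (indicator (- K)) L y"

lemma costs_nonneg: "0 \<le> letter_cost" "0 \<le> error_cost" "0 \<le> \<alpha> \<Longrightarrow> 0 \<le> base_cost \<alpha>"
proof -
  show "0 \<le> letter_cost" unfolding letter_cost_def using card_S by (intro ln_ge_zero) linarith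
  have "1 \<le> card S / \<gamma>" using card_S \<gamma> by (simp add: divide_simps)
  then show ec: "0 \<le> error_cost" unfolding error_cost_def by (rule ln_ge_zero)
  have "0 \<le> ln (2 * T)" using T_pos by (intro ln_ge_zero) linarith
  then have "0 \<le> ln (2 * T) / n" by simp
  moreover have "ln (1 - \<gamma>) \<le> 0" using \<gamma> by simp
  ultimately show "0 \<le> base_cost \<alpha>" if "0 \<le> \<alpha>"
    unfolding base_cost_def using mult_nonneg_nonneg[OF that ec] by linarith
qed

lemma indicator_sum_nonneg: "0 \<le> birkhoff_sum f (indicator B) m y"
  unfolding birkhoff_sum_def by (simp add: sum_nonneg)

context
  fixes f :: "'a \<Rightarrow> 'a" and e :: "'a \<Rightarrow> 'b" and D K :: "'a set" and \<alpha> :: real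
  assumes e: "\<And>x. e x \<in> S" and \<alpha>: "0 \<le> \<alpha>"
    and copy: "\<And>y. y \<in> D \<Longrightarrow> \<exists>k<T.
      real (card {i. i < n \<and> e ((f ^^ i) y) \<noteq> \<tau> (e ((f ^^ (i + Suc k)) y))})
        \<le> birkhoff_sum f (indicator (- K)) n y + \<alpha> * real n"
begin

text \<open>A greedy parse bounds the mixture from below: a single letter near the end or outside
  \<open>D\<close>, otherwise a block copied at the distance given by \<open>copy\<close>.\<close>

lemma omega_itinerary: "exp (- cost f D K \<alpha> L y) \<le> omega (itinerary f e L y)"
proof (induction L arbitrary: y rule: less_induct)
  case (less L)
  show ?case
  proof (cases L)
    case 0
    then show ?thesis by (simp add: cost_def)
  next
    case (Suc L')
    let ?w = "itinerary f e L y"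
    show ?thesis
    proof (cases "L \<le> n + T \<or> y \<notin> D")
      case True
      have "letter_cost + cost f D K \<alpha> L' (f y) \<le> cost f D K \<alpha> L y"
      proof -
        have "letter_cost + letter_cost * real (min L' (n + T))
            + letter_cost * birkhoff_sum f (indicator (- D)) L' (f y)
          \<le> letter_cost * real (min L (n + T)) + letter_cost * birkhoff_sum f (indicator (- D)) L y"
        proof (cases "L \<le> n + T")
          case True
          then have "real (min L (n + T)) = 1 + real (min L' (n + T))" using Suc by simp
          then show ?thesis using costs_nonneg \<alpha>
            by (auto simp: Suc birkhoff_sum_Suc algebra_simps indicator_def)
        next
          case False
          then have "y \<notin> D" "min L (n + T) = min L' (n + T)" using \<open>L \<le> n + T \<or> y \<notin> D\<close> Suc by auto
          then show ?thesis using Suc by (simp add: birkhoff_sum_Suc algebra_simps)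
        qed
        moreover have "base_cost \<alpha> * real L' \<le> base_cost \<alpha> * real L"
          using costs_nonneg \<alpha> Suc by (intro mult_left_mono) auto
        moreover have "error_cost * birkhoff_sum f (indicator (- K)) L' (f y)
            \<le> error_cost * birkhoff_sum f (indicator (- K)) L y"
          using costs_nonneg \<alpha> Suc by (intro mult_left_mono) (auto simp: birkhoff_sum_Suc)
        ultimately show ?thesis unfolding cost_def by linarith
      qed
      then have "exp (- cost f D K \<alpha> L y) \<le> exp (- letter_cost) * exp (- cost f D K \<alpha> L' (f y))"
        by (simp add: mult_exp_exp)
      also have "\<dots> \<le> 1 / (2 * card S) * omega (itinerary f e L' (f y))"
      proof -
        have "exp (- letter_cost) = 1 / (2 * card S)"
          using card_S by (simp add: letter_cost_def exp_minus inverse_eq_divide)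
        moreover have "exp (- cost f D K \<alpha> L' (f y)) \<le> omega (itinerary f e L' (f y))"
          by (rule less.IH) (simp add: Suc)
        ultimately show ?thesis by (simp add: mult_left_mono divide_right_mono)
      qed
      also have "\<dots> \<le> omega ?w"
        unfolding Suc by (auto intro!: mult_nonneg_nonneg divide_nonneg_nonneg sum_nonneg copy_weight_nonneg omega_nonneg)
      finally show ?thesis .
    next
      case False
      then have L: "n + T < L" and "y \<in> D" by auto
      define m where "m = L - n"
      have m: "L = n + m" "m < L" using L n_pos by (auto simp: m_def)
      let ?E = "\<lambda>k. {i. i < n \<and> e ((f ^^ i) y) \<noteq> \<tau> (e ((f ^^ (i + Suc k)) y))}"
      obtain k where k: "k < T" "real (card (?E k)) \<le> birkhoff_sum f (indicator (- K)) n y + \<alpha> * real n"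
        using copy[OF \<open>y \<in> D\<close>] by blast
      \<comment> \<open>As \<open>Suc k \<le> T\<close> and \<open>n + T < L\<close>, all sources
        lie inside the word.\<close>
      have E: "{i. i < n \<and> ?w ! i \<noteq> \<tau> (?w ! (i + Suc k))} = ?E k"
        using L k by auto
      let ?a = "real n * ln (1 - \<gamma>) - error_cost * real (card (?E k))"
      have "ln (2 * T) - ?a + cost f D K \<alpha> m ((f ^^ n) y) \<le> cost f D K \<alpha> L y"
      proof -
        have "error_cost * real (card (?E k)) \<le>
            error_cost * (birkhoff_sum f (indicator (- K)) n y + \<alpha> * real n)"
          using k costs_nonneg \<alpha> by (intro mult_left_mono) auto
        moreover have "base_cost \<alpha> * real L = ln (2 * T) - real n * ln (1 - \<gamma>) + \<alpha> * error_cost * real n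
            + base_cost \<alpha> * real m"
          using n_pos by (simp add: m base_cost_def field_simps)
        moreover have "letter_cost * real (min m (n + T)) \<le> letter_cost * real (min L (n + T))"
          using costs_nonneg \<alpha> m by (intro mult_left_mono) auto
        moreover have "letter_cost * birkhoff_sum f (indicator (- D)) m ((f ^^ n) y)
            \<le> letter_cost * birkhoff_sum f (indicator (- D)) L y"
          using costs_nonneg \<alpha> by (intro mult_left_mono) (auto simp: m birkhoff_sum_add indicator_sum_nonneg)
        ultimately show ?thesis unfolding cost_def m birkhoff_sum_add
          by (simp add: algebra_simps)
      qed
      then have "exp (- cost f D K \<alpha> L y) \<le> exp (- ln (2 * T)) * exp ?a * exp (- cost f D K \<alpha> m ((f ^^ n) y))"
        by (simp add: mult_exp_exp)
      also have "\<dots> \<le> 1 / (2 * T) * (\<Sum>k<T. copy_weight n (Suc k) ?w) * omega (itinerary f e m ((f ^^ n) y))"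
      proof (intro mult_mono)
        have "exp ?a \<le> copy_weight n (Suc k) ?w"
          using copy_weight_lower[of n ?w "Suc k"] unfolding E error_cost_def .
        also have "\<dots> \<le> (\<Sum>k<T. copy_weight n (Suc k) ?w)"
          using k copy_weight_nonneg by (intro member_le_sum) auto
        finally show "exp ?a \<le> (\<Sum>k<T. copy_weight n (Suc k) ?w)" .
        show "exp (- cost f D K \<alpha> m ((f ^^ n) y)) \<le> omega (itinerary f e m ((f ^^ n) y))"
          by (rule less.IH) (use m in simp)
        show "exp (- ln (2 * T)) \<le> 1 / (2 * T)" using T_pos by (simp add: exp_minus inverse_eq_divide)
      qed (auto intro!: mult_nonneg_nonneg divide_nonneg_nonneg sum_nonneg copy_weight_nonneg)
      also have "\<dots> \<le> omega ?w"
      proof -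
        have "drop n ?w = itinerary f e m ((f ^^ n) y)" by (simp add: m(1) itinerary_add)
        moreover obtain s v where w: "?w = s # v" using Suc by auto
        moreover have "n \<le> length (s # v)" unfolding w[symmetric] using L by simp
        ultimately show ?thesis
          using omega_nonneg[of v] by simp
      qed
      finally show ?thesis .
    qed
  qed
qed

end

end

section \<open>From code lengths to an entropy bound\<close>

context labelled_mpt
begin

text \<open>By Gibbs' inequality, \<open>H L\<close> is at most the mean code length. The code works
  with the richer labels \<open>e\<close>; its image \<open>q\<close> under \<pi> is a
  subprobability on words over \<open>A\<close>. Dividing by \<open>L\<close> removes the cost of
  the last \<open>n + T\<close> letters in the limit.\<close>

lemma entropy_copy_bound:
  fixes e :: "'a \<Rightarrow> 'd"
  assumes code: "copy_code S \<gamma> n T"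
    and e: "\<And>x. e x \<in> S" and \<alpha>: "0 \<le> \<alpha>" and c: "\<And>x. c x = \<pi> (e x)"
    and [measurable]: "D \<in> sets M" "K \<in> sets M"
    and copy: "\<And>y. y \<in> D \<Longrightarrow> \<exists>k<T.
      real (card {i. i < n \<and> e ((f ^^ i) y) \<noteq> \<tau> (e ((f ^^ (i + Suc k)) y))})
        \<le> birkhoff_sum f (indicator (- K)) n y + \<alpha> * real n"
  shows "entropy_rate \<le> ln (2 * real T) / n - ln (1 - \<gamma>) + \<alpha> * ln (card S / \<gamma>)
    + ln (2 * real (card S)) * prob (- D) + ln (card S / \<gamma>) * prob (- K)"
    (is "_ \<le> ?R")
proof -
  interpret C: copy_code S \<tau> \<gamma> n T by (rule code)
  let ?cost = "C.cost f D K \<alpha>"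
  note omega = C.omega_itinerary[of e \<alpha> D f K, OF e \<alpha> copy]
  have comp: "- B \<in> sets M" if "B \<in> sets M" for B
    using sets.compl_sets[OF that] by (simp add: Compl_eq_Diff_UNIV)
  have ind: "indicator (- B) \<in> borel_measurable M" "integrable M (\<lambda>x. birkhoff_sum f (indicator (- B)) L x)"
    "(\<integral>x. birkhoff_sum f (indicator (- B)) L x \<partial>M) = real L * prob (- B)"
    if "B \<in> sets M" for B :: "'a set" and L
  proof -
    show m: "indicator (- B) \<in> borel_measurable M" using comp[OF that] by simp
    have "\<bar>birkhoff_sum f (indicator (- B)) L x\<bar> \<le> real L" for x
    proof -
      have "\<bar>birkhoff_sum f (indicator (- B)) L x\<bar> \<le> (\<Sum>i<L. 1)"
        unfolding birkhoff_sum_def by (rule order_trans[OF sum_abs sum_mono]) (simp add: indicator_def)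
      then show ?thesis by simp
    qed
    then show "integrable M (\<lambda>x. birkhoff_sum f (indicator (- B)) L x)"
      by (intro integrable_bounded birkhoff_sum_measurable m)
    show "(\<integral>x. birkhoff_sum f (indicator (- B)) L x \<partial>M) = real L * prob (- B)"
    proof -
      have "\<bar>indicator (- B) x :: real\<bar> \<le> 1" for x by (simp add: indicator_def)
      from integral_birkhoff_sum[OF m this, of L] show ?thesis using comp[OF that] by simp
    qed
  qed
  have H_le: "H L \<le> C.letter_cost * real (n + T) + real L * ?R" for L
  proof -
    define q where "q u = (\<Sum>w\<in>words S L. if map \<pi> w = u then C.omega w else 0)" for u
    have q_ge: "exp (- ?cost L x) \<le> q (itin L x)" for x
    proof -
      let ?w = "itinerary f e L x"
      have w: "?w \<in> words S L" "map \<pi> ?w = itin L x"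
        using e by (auto simp: words_def set_conv_nth c intro!: nth_equalityI)
      have "exp (- ?cost L x) \<le> C.omega ?w" by (rule omega)
      also have "\<dots> = (if map \<pi> ?w = itin L x then C.omega ?w else 0)" using w by simp
      also have "\<dots> \<le> q (itin L x)"
        unfolding q_def by (rule member_le_sum[OF w(1)]) (auto simp: C.omega_nonneg C.finite_S)
      finally show ?thesis .
    qed
    have q_pos: "0 < q (itin L x)" for x
      using q_ge[of x] exp_gt_zero less_le_trans by blast
    have "H L \<le> (\<integral>x. - ln (q (itin L x)) \<partial>M)"
    proof (rule gibbs_inequality)
      show "0 \<le> q w" for w unfolding q_def by (intro sum_nonneg) (simp add: C.omega_nonneg)
      have "(\<Sum>u\<in>words A L. q u) = (\<Sum>w\<in>words S L. \<Sum>u\<in>words A L. if map \<pi> w = u then C.omega w else 0)"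
        unfolding q_def by (rule sum.swap)
      also have "\<dots> \<le> (\<Sum>w\<in>words S L. C.omega w)"
        using finite_A by (intro sum_mono) (simp add: sum.delta' C.omega_nonneg)
      also have "\<dots> \<le> 1" by (rule C.sum_omega)
      finally show "(\<Sum>u\<in>words A L. q u) \<le> 1" .
      fix w assume w: "w \<in> words A L" "0 < pr w"
      \<comment> \<open>A word of positive probability is the itinerary of some point, and there
        \<open>q_pos\<close> applies.\<close>
      then have "cyl w \<noteq> {}" by (auto simp: pr_def)
      then obtain x where "itin (length w) x = w" by (auto simp: cyl_def)
      then show "0 < q w" using q_pos[of x] w by (simp add: length_words)
    qed
    also have "\<dots> \<le> (\<integral>x. ?cost L x \<partial>M)"
    proof (rule integral_mono)
      show "integrable M (\<lambda>x. - ln (q (itin L x)))"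
        using integrable_itin[of "\<lambda>w. - ln (q w)"] .
      show "integrable M (\<lambda>x. ?cost L x)"
        unfolding C.cost_def by (intro Bochner_Integration.integrable_add integrable_mult_right ind) auto
      fix x
      have "- ?cost L x \<le> ln (q (itin L x))"
        using q_ge[of x] q_pos[of x] by (simp add: ln_ge_iff)
      then show "- ln (q (itin L x)) \<le> ?cost L x" by simp
    qed
    also have "\<dots> = C.letter_cost * real (min L (n + T)) + C.base_cost \<alpha> * real L
        + C.letter_cost * (real L * prob (- D)) + C.error_cost * (real L * prob (- K))"
      unfolding C.cost_def using ind prob_space by simp
    also have "\<dots> \<le> C.letter_cost * real (n + T) + real L * ?R"
    proof -
      have "C.letter_cost * real (min L (n + T)) \<le> C.letter_cost * real (n + T)"
        using C.costs_nonneg by (intro mult_left_mono) auto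
      then show ?thesis
        by (simp add: C.base_cost_def C.letter_cost_def C.error_cost_def algebra_simps)
    qed
    finally show ?thesis .
  qed
  have "(\<lambda>L. ?R + C.letter_cost * real (n + T) / real L) \<longlonglongrightarrow> ?R + 0"
    by (intro tendsto_intros tendsto_divide_0[OF tendsto_const] filterlim_real_at_infinity_sequentially)
  moreover have "H L / real L \<le> ?R + C.letter_cost * real (n + T) / real L" if "L \<ge> 1" for L
  proof -
    have "H L / real L \<le> (C.letter_cost * real (n + T) + real L * ?R) / real L"
      using H_le by (rule divide_right_mono) simp
    also have "\<dots> = ?R + C.letter_cost * real (n + T) / real L"
      using that by (simp add: add_divide_distrib)
    finally show ?thesis .
  qed
  ultimately have "entropy_rate \<le> ?R + 0"
    by (intro LIMSEQ_le[OF entropy_rate]) blast+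
  then show ?thesis by simp
qed

end

section \<open>Quick returns with few errors\<close>

locale compact_ergodic = ergodic_mpt M f for M :: "'a::metric_space measure" and f +
  assumes compact_UNIV: "compact (UNIV :: 'a set)"
    and continuous_f: "continuous_on UNIV f"
    and sets_borel: "sets M = sets borel"
begin

definition near_return :: "real \<Rightarrow> nat \<Rightarrow> nat \<Rightarrow> 'a \<Rightarrow> bool" where
  "near_return \<epsilon> n t x \<longleftrightarrow>
     real (card {i. i < n \<and> \<epsilon> \<le> dist ((f ^^ i) x) ((f ^^ (i + t)) x)}) \<le> \<epsilon> * real n"

text \<open>The parameter \<epsilon> is at once the distance threshold, the density of errors and
  the slack in the exponent, so one sequence of scales controls all three. A density in place of the
  mistake function keeps these sets independent of it.\<close>

definition quick_returns :: "real \<Rightarrow> real \<Rightarrow> nat \<Rightarrow> 'a set" where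
  "quick_returns h \<epsilon> n = {x. \<exists>t\<ge>1. real t \<le> exp ((h + \<epsilon>) * real n) \<and> near_return \<epsilon> n t x}"

definition quickly_returning :: "real \<Rightarrow> 'a set" where
  "quickly_returning h = {x. \<forall>m. \<forall>\<^sub>F n in sequentially. x \<in> quick_returns h (1 / Suc m) n}"

lemma continuous_funpow: "continuous_on UNIV (f ^^ n)"
proof (induction n)
  case (Suc n)
  then show ?case
    using continuous_on_compose[of UNIV "f ^^ n" f] continuous_on_subset[OF continuous_f] by auto
qed (simp add: id_def)

lemma continuous_measurable:
  assumes "continuous_on UNIV (\<psi> :: 'a \<Rightarrow> real)"
  shows "\<psi> \<in> borel_measurable M"
  using borel_measurable_continuous_onI[OF assms] measurable_cong_sets[OF sets_borel refl] by blast

lemma quick_returns_sets [measurable]: "quick_returns h \<epsilon> n \<in> sets M"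
proof -
  have [measurable]: "(\<lambda>x. dist ((f ^^ i) x) ((f ^^ j) x)) \<in> borel_measurable M" for i j
    by (intro continuous_measurable continuous_intros continuous_funpow)
  have "real (card {i. i < n \<and> \<epsilon> \<le> dist ((f ^^ i) x) ((f ^^ (i + t)) x)}) =
      (\<Sum>i<n. if \<epsilon> \<le> dist ((f ^^ i) x) ((f ^^ (i + t)) x) then 1 else 0)" for t x
    by (simp add: sum.If_cases Int_def)
  then have "quick_returns h \<epsilon> n = {x \<in> space M. \<exists>t\<ge>1. real t \<le> exp ((h + \<epsilon>) * real n) \<and>
      (\<Sum>i<n. if \<epsilon> \<le> dist ((f ^^ i) x) ((f ^^ (i + t)) x) then 1 else 0) \<le> \<epsilon> * real n}"
    by (simp add: quick_returns_def near_return_def)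
  also have "\<dots> \<in> sets M" by measurable
  finally show ?thesis .
qed

lemma quickly_returning_sets [measurable]: "quickly_returning h \<in> sets M"
proof -
  have "quickly_returning h = {x \<in> space M. \<forall>m. \<exists>N. \<forall>n\<ge>N. x \<in> quick_returns h (1 / Suc m) n}"
    by (simp add: quickly_returning_def eventually_sequentially)
  also have "\<dots> \<in> sets M" by measurable
  finally show ?thesis .
qed

text \<open>A return of the block of length \<open>n + 1\<close> at \<open>x\<close> gives one of
  the block of length \<open>n\<close> at \<open>f x\<close>. Starting from the scale \<epsilon>/2
  leaves room for the extra letter, both in the exponent and in the number of errors.\<close>

lemma quickly_returning_subinvariant:
  assumes "x \<in> quickly_returning h"
  shows "f x \<in> quickly_returning h"
  unfolding quickly_returning_def
proof (rule CollectI, rule allI)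
  fix m
  define \<epsilon> where "\<epsilon> = 1 / real (Suc m)"
  \<comment> \<open>Chosen so that the scale \<open>1 / Suc m'\<close> is half of
    \<open>1 / Suc m\<close>.\<close>
  define m' where "m' = 2 * m + 1"
  have \<epsilon>: "0 < \<epsilon>" "1 / real (Suc m') = \<epsilon> / 2" by (simp_all add: \<epsilon>_def m'_def divide_simps)
  have "\<forall>\<^sub>F n in sequentially. x \<in> quick_returns h (\<epsilon> / 2) n"
    using assms unfolding quickly_returning_def \<epsilon>(2)[symmetric] by blast
  then have "\<forall>\<^sub>F n in sequentially. x \<in> quick_returns h (\<epsilon> / 2) (Suc n)"
    by (rule eventually_sequentially_Suc[THEN iffD2])
  moreover have "\<forall>\<^sub>F n in sequentially. (h + \<epsilon> / 2) / (\<epsilon> / 2) \<le> real n"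
    using filterlim_real_sequentially by (auto simp: filterlim_at_top)
  ultimately show "\<forall>\<^sub>F n in sequentially. f x \<in> quick_returns h (1 / Suc m) n"
    using eventually_ge_at_top[of 1]
  proof eventually_elim
    case (elim n)
    then obtain t where t: "t \<ge> 1" "real t \<le> exp ((h + \<epsilon> / 2) * real (Suc n))" "near_return (\<epsilon> / 2) (Suc n) t x"
      unfolding quick_returns_def by blast
    have "h + \<epsilon> / 2 \<le> real n * (\<epsilon> / 2)" using elim(2) \<epsilon>(1) by (simp add: divide_simps)
    moreover have "(h + \<epsilon> / 2) * real (Suc n) = (h + \<epsilon> / 2) * real n + (h + \<epsilon> / 2)"
      "(h + \<epsilon>) * real n = (h + \<epsilon> / 2) * real n + real n * (\<epsilon> / 2)"
      by (simp_all add: algebra_simps)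
    ultimately have "(h + \<epsilon> / 2) * real (Suc n) \<le> (h + \<epsilon>) * real n" by linarith
    then have "real t \<le> exp ((h + \<epsilon>) * real n)" using t(2) by (meson exp_le_cancel_iff order_trans)
    moreover have "near_return \<epsilon> n t (f x)"
    proof -
      have "card {i. i < n \<and> \<epsilon> \<le> dist ((f ^^ i) (f x)) ((f ^^ (i + t)) (f x))}
          \<le> card {i. i < Suc n \<and> \<epsilon> / 2 \<le> dist ((f ^^ i) x) ((f ^^ (i + t)) x)}"
        using \<epsilon>(1) by (intro card_inj_on_le[where f = Suc]) (auto simp: funpow_swap1)
      also have "real \<dots> \<le> \<epsilon> / 2 * real (Suc n)" using t(3) by (simp add: near_return_def)
      also have "\<dots> \<le> \<epsilon> * real n" using elim(3) \<epsilon> by (simp add: field_simps)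
      finally show ?thesis by (simp add: near_return_def)
    qed
    ultimately show ?case using t(1) unfolding quick_returns_def \<epsilon>_def by blast
  qed
qed

text \<open>A point near \<open>z\<close> may lie in another cell. Its substitute label
  \<open>b\<close>, which need not be its own cell, still reveals the cell of \<open>z\<close>
  whenever \<open>z\<close> lies in the large set \<open>K\<close>.\<close>

lemma closed_core:
  assumes P: "finite_measurable_partition M P" and "\<beta> > 0"
  obtains K b e where "K \<in> sets M" "prob (- K) \<le> \<beta>" "e > 0" "\<And>z. b z \<in> P"
    "\<And>z z'. z \<in> K \<Longrightarrow> dist z z' < e \<Longrightarrow> b z' = cell_of P z"
proof -
  have fin: "finite P" and sub: "P \<subseteq> sets M" and ne: "P \<noteq> {}"
    using P cell_of_in[OF P] unfolding finite_measurable_partition_def by auto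
  then have card: "0 < real (card P)" by (simp add: card_gt_0_iff)
  have "\<exists>K. closed K \<and> K \<subseteq> B \<and> prob (B - K) \<le> \<beta> / card P" if "B \<in> P" for B
  proof -
    have "B \<in> sets M" using sub that by blast
    from closed_open_approx[OF finite_measure_axioms sets_borel this, of "\<beta> / card P"]
    obtain K U where K: "closed K" "open U" "K \<subseteq> B" "B \<subseteq> U" "prob (U - K) < \<beta> / card P"
      using \<open>\<beta> > 0\<close> card by auto
    have "prob (B - K) \<le> prob (U - K)"
      using K by (intro finite_measure_mono) (auto simp: sets_borel)
    then show ?thesis using K by (intro exI[of _ K]) auto
  qed
  then obtain C where C: "\<And>B. B \<in> P \<Longrightarrow> closed (C B)" "\<And>B. B \<in> P \<Longrightarrow> C B \<subseteq> B"
    "\<And>B. B \<in> P \<Longrightarrow> prob (B - C B) \<le> \<beta> / card P"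
    by metis
  define K where "K = (\<Union>B\<in>P. C B)"
  have "closed K" unfolding K_def using fin C(1) by (intro closed_UN) auto
  then have K_sets: "K \<in> sets M" by (simp add: sets_borel)
  have CB: "C B \<in> sets M" if "B \<in> P" for B using C(1)[OF that] by (simp add: sets_borel)
  have "prob (- K) \<le> prob (\<Union>B\<in>P. B - C B)"
  proof (rule finite_measure_mono)
    show "- K \<subseteq> (\<Union>B\<in>P. B - C B)"
    proof
      fix x assume "x \<in> - K"
      then show "x \<in> (\<Union>B\<in>P. B - C B)"
        using cell_of_in[OF P, of x] cell_of_eq[OF P cell_of_in[OF P, of x], of x] by (auto simp: K_def)
    qed
    show "(\<Union>B\<in>P. B - C B) \<in> sets M" using fin CB sub by (intro sets.finite_UN) auto
  qed
  also have "\<dots> \<le> (\<Sum>B\<in>P. prob (B - C B))"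
    using fin CB sub by (intro finite_measure_subadditive_finite) auto
  also have "\<dots> \<le> (\<Sum>B\<in>P. \<beta> / card P)" by (intro sum_mono C(3))
  also have "\<dots> = \<beta>" using card by simp
  finally have K_prob: "prob (- K) \<le> \<beta>" .
  have cell: "cell_of P z = B" if "B \<in> P" "z \<in> C B" for B z
    using cell_of_eq[OF P that(1)] C(2)[OF that(1)] that(2) by blast
  \<comment> \<open>\<open>V B\<close> omits the closed cores of all other cells, so among the
    points of \<open>K\<close> it contains only those of the core of \<open>B\<close>; points
    outside \<open>K\<close> belong to every \<open>V B\<close>.\<close>
  define V where "V B = - (\<Union>B'\<in>P - {B}. C B')" for B
  have V_open: "open (V B)" for B
    unfolding V_def using fin C(1) by (intro open_Compl closed_UN) auto
  have V_cover: "\<exists>B\<in>P. x \<in> V B" for x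
  proof (cases "x \<in> K")
    case True
    then obtain B where "B \<in> P" "x \<in> C B" by (auto simp: K_def)
    then show ?thesis using cell by (intro bexI[of _ B]) (auto simp: V_def)
  next
    case False
    then show ?thesis using ne by (auto simp: V_def K_def)
  qed
  \<comment> \<open>A Lebesgue number of the cover by the sets \<open>V B\<close>;
    \<open>b x\<close> then names a member containing the ball about \<open>x\<close>.\<close>
  obtain e where e: "e > 0" "\<And>x. \<exists>G\<in>V ` P. ball x e \<subseteq> G"
  proof (rule Heine_Borel_lemma[OF compact_UNIV, of "V ` P"])
    show "UNIV \<subseteq> \<Union> (V ` P)" using V_cover by blast
    show "open G" if "G \<in> V ` P" for G using V_open that by blast
  qed (use that in blast)
  have "\<forall>x. \<exists>B. B \<in> P \<and> ball x e \<subseteq> V B" using e(2) by blast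
  then obtain b where b: "\<And>x. b x \<in> P" "\<And>x. ball x e \<subseteq> V (b x)" by metis
  have "b z' = cell_of P z" if "z \<in> K" "dist z z' < e" for z z'
  proof -
    obtain B where B: "B \<in> P" "z \<in> C B" using \<open>z \<in> K\<close> by (auto simp: K_def)
    have "z \<in> V (b z')" using b(2)[of z'] that(2) by (auto simp: dist_commute)
    then have "b z' = B" using B by (auto simp: V_def)
    then show ?thesis using cell[OF B] by simp
  qed
  with K_sets K_prob e(1) b(1) show thesis by (rule that)
qed

lemma entropy_le_of_quick_returns:
  assumes P: "finite_measurable_partition M P" and full: "prob (quickly_returning h) = 1"
  shows "entropy_wrt_partition M f P \<le> h"
proof -
  interpret L: labelled_mpt M f P "cell_of P" by (rule labelled_mpt_cell_of[OF P])
  have "L.entropy_rate \<le> h + 5 * \<eta>" if "\<eta> > 0" for \<eta> :: real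
  proof -
    \<comment> \<open>Makes the cost \<open>- ln (1 - \<gamma>)\<close> of a correct prediction
      equal to \<eta>.\<close>
    define \<gamma> where "\<gamma> = 1 - exp (- \<eta>)"
    have \<gamma>: "0 < \<gamma>" "\<gamma> < 1" "ln (1 - \<gamma>) = - \<eta>" using \<open>\<eta> > 0\<close> by (auto simp: \<gamma>_def)
    let ?S = "P \<times> P"
    have "0 < card ?S" using L.card_A_pos by (simp add: card_cartesian_product)
    then have S: "1 \<le> real (card ?S)" by linarith
    define c1 where "c1 = ln (2 * real (card ?S))"
    define c2 where "c2 = ln (real (card ?S) / \<gamma>)"
    have c1: "0 \<le> c1" unfolding c1_def using S by (intro ln_ge_zero) simp
    have c2: "0 \<le> c2" unfolding c2_def using S \<gamma> by (intro ln_ge_zero) (simp add: divide_simps)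
    \<comment> \<open>Small enough that exceptional sets of measure \<beta>, weighted by the costs
      \<open>c1\<close> and \<open>c2\<close>, cost at most \<eta>.\<close>
    define \<beta> where "\<beta> = \<eta> / (c1 + c2 + 1 + \<eta>)"
    have \<beta>: "0 < \<beta>" "\<beta> < 1" "\<beta> \<le> \<eta>" "\<beta> * c2 \<le> \<eta>" "\<beta> * (c1 + c2) \<le> \<eta>"
    proof -
      have d: "0 < c1 + c2 + 1 + \<eta>" using c1 c2 \<open>\<eta> > 0\<close> by simp
      show pos: "0 < \<beta>" unfolding \<beta>_def using d \<open>\<eta> > 0\<close> by simp
      show "\<beta> < 1" unfolding \<beta>_def using d c1 c2 by (simp add: divide_simps)
      have eq: "\<beta> * (c1 + c2 + 1 + \<eta>) = \<eta>" unfolding \<beta>_def using d by simp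
      have "0 \<le> \<beta> * c1" "0 \<le> \<beta> * c2" "0 \<le> \<beta> * \<eta>" using pos c1 c2 \<open>\<eta> > 0\<close> by simp_all
      moreover have "\<beta> * c1 + \<beta> * c2 + \<beta> + \<beta> * \<eta> = \<eta>" using eq by (simp add: algebra_simps)
      ultimately show "\<beta> \<le> \<eta>" "\<beta> * c2 \<le> \<eta>" "\<beta> * (c1 + c2) \<le> \<eta>"
        using pos by (simp_all add: algebra_simps)
    qed
    obtain K b e where K: "K \<in> sets M" "prob (- K) \<le> \<beta>" "e > 0" "\<And>z. b z \<in> P"
      "\<And>z z'. z \<in> K \<Longrightarrow> dist z z' < e \<Longrightarrow> b z' = cell_of P z"
      by (rule closed_core[OF P \<beta>(1)], rule that)
    have "0 < min e \<beta>" using K \<beta> by simp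
    then obtain m where m: "1 / real (Suc m) < min e \<beta>" using nat_approx_posE by blast
    define \<epsilon> where "\<epsilon> = 1 / real (Suc m)"
    have \<epsilon>: "0 < \<epsilon>" "\<epsilon> < e" "\<epsilon> < \<beta>" using m by (auto simp: \<epsilon>_def)
    \<comment> \<open>The sets \<open>E N\<close> increase and cover
      \<open>quickly_returning h\<close>, so one block length \<open>n\<close> serves all points up
      to measure \<beta>.\<close>
    define E where "E N = {x. \<forall>n\<ge>N. x \<in> quick_returns h \<epsilon> n}" for N
    have E_sets: "E N \<in> sets M" for N
    proof -
      have "E N = {x \<in> space M. \<forall>n\<ge>N. x \<in> quick_returns h \<epsilon> n}" by (simp add: E_def)
      also have "\<dots> \<in> sets M" by measurable
      finally show ?thesis .
    qed
    have "quickly_returning h \<subseteq> (\<Union>N. E N)"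
      by (auto simp: quickly_returning_def E_def \<epsilon>_def eventually_sequentially)
    then have "prob (quickly_returning h) \<le> prob (\<Union>N. E N)"
      using E_sets by (intro finite_measure_mono sets.countable_UN) auto
    then have "prob (\<Union>N. E N) = 1" using full prob_le_1[of "\<Union>N. E N"] by linarith
    moreover have "(\<lambda>N. prob (E N)) \<longlonglongrightarrow> prob (\<Union>N. E N)"
    proof (rule finite_Lim_measure_incseq)
      show "range E \<subseteq> sets M" using E_sets by blast
      show "incseq E" by (rule incseq_SucI) (auto simp: E_def)
    qed
    ultimately have "\<forall>\<^sub>F N in sequentially. 1 - \<beta> < prob (E N)"
      using \<beta>(1) by (intro order_tendstoD(1)) auto
    moreover have "\<forall>\<^sub>F N in sequentially. ln 2 / \<eta> \<le> real N"
      using filterlim_real_sequentially by (auto simp: filterlim_at_top)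
    ultimately have "\<forall>\<^sub>F N in sequentially. 1 - \<beta> < prob (E N) \<and> ln 2 / \<eta> \<le> real N \<and> 1 \<le> N"
      using eventually_ge_at_top[of 1] by eventually_elim simp
    then obtain n where n: "1 - \<beta> < prob (E n)" "ln 2 / \<eta> \<le> real n" "1 \<le> n"
      by (auto dest!: eventually_happens'[OF sequentially_bot])
    define D where "D = quick_returns h \<epsilon> n"
    have D_sets: "D \<in> sets M" by (simp add: D_def)
    have "prob (E n) \<le> prob D"
      using D_sets by (intro finite_measure_mono) (auto simp: E_def D_def)
    moreover have "prob (- D) = 1 - prob D"
      using prob_compl[OF D_sets] by (simp add: Compl_eq_Diff_UNIV)
    ultimately have D_prob: "prob (- D) \<le> \<beta>" "0 < prob D" using n(1) \<beta>(2) by auto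
    define T where "T = nat \<lfloor>exp ((h + \<epsilon>) * real n)\<rfloor>"
    have T: "t \<le> T" if "real t \<le> exp ((h + \<epsilon>) * real n)" for t
      using that by (simp add: T_def le_nat_floor)
    \<comment> \<open>A point of \<open>D\<close> has a return time \<open>t \<ge> 1\<close> below
      the bound, so \<open>T\<close> is positive whatever the sign of \<open>h\<close>.\<close>
    have "D \<noteq> {}" using D_prob(2) by auto
    then obtain t where "t \<ge> 1" "real t \<le> exp ((h + \<epsilon>) * real n)"
      by (auto simp: D_def quick_returns_def)
    then have T_pos: "0 < T" using T[of t] by linarith
    have T_le: "real T \<le> exp ((h + \<epsilon>) * real n)" unfolding T_def by (simp add: of_nat_nat)
    \<comment> \<open>The prediction reads \<open>b\<close> at the source and expects it as both
      components at the target. It is right when the target lies in \<open>K\<close> and the source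
      within \<open>e\<close> of it.\<close>
    let ?e = "\<lambda>x. (b x, cell_of P x)"
    let ?\<tau> = "\<lambda>(s, s'). (s, s)"
    have "L.entropy_rate \<le> ln (2 * real T) / n - ln (1 - \<gamma>) + \<epsilon> * c2 + c1 * prob (- D) + c2 * prob (- K)"
      unfolding c1_def c2_def
    proof (rule L.entropy_copy_bound[where e = ?e and \<tau> = ?\<tau> and \<pi> = snd])
      show "copy_code ?S \<gamma> n T"
        using L.finite_A L.card_A_pos \<gamma> n(3) T_pos by unfold_locales auto
      show "?e x \<in> ?S" for x using K(4) L.label_in by simp
      show "0 \<le> \<epsilon>" using \<epsilon> by simp
      fix y assume "y \<in> D"
      then obtain t where t: "t \<ge> 1" "real t \<le> exp ((h + \<epsilon>) * real n)" "near_return \<epsilon> n t y"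
        unfolding D_def quick_returns_def by blast
      let ?N = "{i. i < n \<and> (f ^^ i) y \<notin> K}"
      let ?F = "{i. i < n \<and> \<epsilon> \<le> dist ((f ^^ i) y) ((f ^^ (i + t)) y)}"
      have "{i. i < n \<and> ?e ((f ^^ i) y) \<noteq> ?\<tau> (?e ((f ^^ (i + t)) y))} \<subseteq> ?N \<union> ?F"
      proof (rule subsetI, rule ccontr)
        fix i
        assume "i \<in> {i. i < n \<and> ?e ((f ^^ i) y) \<noteq> ?\<tau> (?e ((f ^^ (i + t)) y))}" and "i \<notin> ?N \<union> ?F"
        then have i: "(f ^^ i) y \<in> K" "dist ((f ^^ i) y) ((f ^^ (i + t)) y) < \<epsilon>"
          "?e ((f ^^ i) y) \<noteq> ?\<tau> (?e ((f ^^ (i + t)) y))"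
          unfolding Un_iff mem_Collect_eq by (blast, linarith, blast)
        have "b ((f ^^ i) y) = cell_of P ((f ^^ i) y)" using K(5)[OF i(1)] K(3) by simp
        moreover have "b ((f ^^ (i + t)) y) = cell_of P ((f ^^ i) y)"
          using K(5)[OF i(1)] i(2) \<epsilon> by simp
        ultimately show False using i(3) by simp
      qed
      then have "card {i. i < n \<and> ?e ((f ^^ i) y) \<noteq> ?\<tau> (?e ((f ^^ (i + t)) y))} \<le> card (?N \<union> ?F)"
        by (intro card_mono) auto
      also have "\<dots> \<le> card ?N + card ?F" by (rule card_Un_le)
      finally have "real (card {i. i < n \<and> ?e ((f ^^ i) y) \<noteq> ?\<tau> (?e ((f ^^ (i + t)) y))})
          \<le> real (card ?N) + real (card ?F)" by linarith
      also have "real (card ?N) = birkhoff_sum f (indicator (- K)) n y"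
        by (simp add: birkhoff_sum_def indicator_def sum.If_cases Int_def)
      also have "real (card ?F) \<le> \<epsilon> * real n" using t(3) by (simp add: near_return_def)
      finally have "real (card {i. i < n \<and> ?e ((f ^^ i) y) \<noteq> ?\<tau> (?e ((f ^^ (i + t)) y))})
          \<le> birkhoff_sum f (indicator (- K)) n y + \<epsilon> * real n" by simp
      moreover obtain k where "t = Suc k" using t(1) by (cases t) auto
      moreover have "t \<le> T" by (rule T[OF t(2)])
      ultimately show "\<exists>k<T. real (card {i. i < n \<and> ?e ((f ^^ i) y) \<noteq> ?\<tau> (?e ((f ^^ (i + Suc k)) y))})
          \<le> birkhoff_sum f (indicator (- K)) n y + \<epsilon> * real n"
        by (intro exI[of _ k]) simp
    qed (use K D_sets in auto)
    \<comment> \<open>In order: the distance per letter, with \<open>ln 2 / n\<close> and \<epsilon>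
      at most \<eta> each; correct predictions; errors from distant points; and visits outside
      \<open>D\<close> and \<open>K\<close>.\<close>
    also have "\<dots> \<le> (h + 2 * \<eta>) + \<eta> + \<eta> + \<eta>"
    proof -
      have "ln (2 * real T) = ln 2 + ln T" using T_pos by (simp add: ln_mult)
      also have "ln T \<le> (h + \<epsilon>) * real n"
        using T_pos ln_mono[OF T_le] by simp
      also have "ln 2 \<le> \<eta> * real n" using n(2) \<open>\<eta> > 0\<close> by (simp add: divide_simps mult.commute)
      finally have "ln (2 * real T) \<le> (h + \<epsilon> + \<eta>) * real n" by (simp add: algebra_simps)
      then have "ln (2 * real T) / n \<le> h + \<epsilon> + \<eta>" using n(3) by (simp add: divide_simps)
      moreover have "\<epsilon> \<le> \<eta>" using \<epsilon> \<beta> by simp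
      moreover have "\<epsilon> * c2 \<le> \<eta>" using mult_right_mono[of \<epsilon> \<beta> c2] \<epsilon> c2 \<beta> by simp
      moreover have "c1 * prob (- D) + c2 * prob (- K) \<le> \<eta>"
      proof -
        have "c1 * prob (- D) + c2 * prob (- K) \<le> c1 * \<beta> + c2 * \<beta>"
          using c1 c2 D_prob(1) K(2) by (intro add_mono mult_left_mono) auto
        also have "\<dots> \<le> \<eta>" using \<beta>(5) by (simp add: algebra_simps)
        finally show ?thesis .
      qed
      ultimately show ?thesis using \<gamma>(3) by linarith
    qed
    finally show ?thesis by simp
  qed
  note bound = this
  have "L.entropy_rate \<le> h"
  proof (rule field_le_epsilon)
    fix \<eta> :: real assume "0 < \<eta>"
    then show "L.entropy_rate \<le> h + \<eta>" using bound[of "\<eta> / 5"] by simp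
  qed
  then show ?thesis by (simp add: entropy_wrt_partition_eq[OF P])
qed

theorem AE_not_quickly_returning:
  assumes "ereal h < measure_entropy M f"
  shows "AE x in M. x \<notin> quickly_returning h"
proof -
  obtain P where P: "finite_measurable_partition M P" "h < entropy_wrt_partition M f P"
    using assms unfolding measure_entropy_def less_SUP_iff by auto
  then have "prob (quickly_returning h) \<noteq> 1" using entropy_le_of_quick_returns by force
  then have "prob (quickly_returning h) = 0"
    using prob_subinvariant[OF quickly_returning_sets quickly_returning_subinvariant] by blast
  then show ?thesis by (simp add: prob_eq_0)
qed

end

section \<open>Return times to mistake balls\<close>

text \<open>The best index set is the complement of the bad times, so the union over index sets
  reduces to counting bad times.\<close>

lemma mistake_ball_iff:
  assumes "\<epsilon> > 0"
  shows "y \<in> mistake_ball f g n x \<epsilon> \<longleftrightarrow>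
    card {i. i < n \<and> \<epsilon> \<le> dist ((f ^^ i) x) ((f ^^ i) y)} \<le> g n \<epsilon>"
proof -
  let ?B = "{i. i < n \<and> \<epsilon> \<le> dist ((f ^^ i) x) ((f ^^ i) y)}"
  have ball: "y \<in> dyn_ball f \<Lambda> x \<epsilon> \<longleftrightarrow> \<Lambda> \<subseteq> {..<n} - ?B" if "\<Lambda> \<subseteq> {..<n}" for \<Lambda>
  proof -
    have "finite \<Lambda>" using that finite_subset by blast
    then have "y \<in> dyn_ball f \<Lambda> x \<epsilon> \<longleftrightarrow> (\<forall>i\<in>\<Lambda>. dist ((f ^^ i) x) ((f ^^ i) y) < \<epsilon>)"
      using assms by (simp add: dyn_ball_def dyn_dist_def)
    also have "\<dots> \<longleftrightarrow> \<Lambda> \<subseteq> {..<n} - ?B" using that by (auto simp: not_le)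
    finally show ?thesis .
  qed
  have sub: "?B \<subseteq> {..<n}" by auto
  have card: "card ({..<n} - ?B) = n - card ?B" "card ?B \<le> n"
    using card_Diff_subset[OF _ sub] card_mono[OF _ sub] finite_subset[OF sub] by auto
  show ?thesis
  proof
    assume "y \<in> mistake_ball f g n x \<epsilon>"
    then obtain \<Lambda> where L: "\<Lambda> \<subseteq> {..<n}" "n - g n \<epsilon> \<le> card \<Lambda>" "y \<in> dyn_ball f \<Lambda> x \<epsilon>"
      by (auto simp: mistake_ball_def mistake_index_sets_def)
    then have "card \<Lambda> \<le> n - card ?B" using ball card_mono[of "{..<n} - ?B" \<Lambda>] card by simp
    then show "card ?B \<le> g n \<epsilon>" using L(2) card(2) by linarith
  next
    assume "card ?B \<le> g n \<epsilon>"
    then have "{..<n} - ?B \<in> mistake_index_sets g n \<epsilon>"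
      using card by (auto simp: mistake_index_sets_def)
    moreover have "y \<in> dyn_ball f ({..<n} - ?B) x \<epsilon>" by (simp add: ball)
    ultimately show "y \<in> mistake_ball f g n x \<epsilon>" unfolding mistake_ball_def by blast
  qed
qed

lemma birkhoff_sup_ge:
  assumes "\<epsilon> > 0" and B: "\<And>y. \<bar>\<phi> y\<bar> \<le> B"
  shows "birkhoff_sum f \<phi> n x \<le> birkhoff_sup f \<phi> n (mistake_ball f g n x \<epsilon>)"
  unfolding birkhoff_sup_def
proof (rule cSUP_upper)
  show "x \<in> mistake_ball f g n x \<epsilon>" using assms by (simp add: mistake_ball_iff)
  have "birkhoff_sum f \<phi> n y \<le> (\<Sum>i<n. B)" for y
    unfolding birkhoff_sum_def by (rule sum_mono) (use B abs_le_D1 in blast)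
  then show "bdd_above (birkhoff_sum f \<phi> n ` mistake_ball f g n x \<epsilon>)"
    by (intro bdd_aboveI[of _ "\<Sum>i<n. B"]) auto
qed

text \<open>Good times change the summand by at most \<delta>, and the at most
  \<open>g n \<epsilon>\<close> bad ones by at most \<open>2 * B\<close>.\<close>

lemma birkhoff_sup_le:
  assumes "\<epsilon> > 0" and B: "\<And>y. \<bar>\<phi> y\<bar> \<le> B"
    and mod: "\<And>y z. dist y z < \<epsilon> \<Longrightarrow> \<bar>\<phi> y - \<phi> z\<bar> \<le> \<delta>" and "\<delta> \<ge> 0"
  shows "birkhoff_sup f \<phi> n (mistake_ball f g n x \<epsilon>)
    \<le> birkhoff_sum f \<phi> n x + real n * \<delta> + 2 * B * real (g n \<epsilon>)"
  unfolding birkhoff_sup_def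
proof (rule cSUP_least)
  have "x \<in> mistake_ball f g n x \<epsilon>" using assms by (simp add: mistake_ball_iff)
  then show "mistake_ball f g n x \<epsilon> \<noteq> {}" by blast
  fix y assume y: "y \<in> mistake_ball f g n x \<epsilon>"
  let ?E = "\<lambda>i. \<epsilon> \<le> dist ((f ^^ i) x) ((f ^^ i) y)"
  have "birkhoff_sum f \<phi> n y - birkhoff_sum f \<phi> n x = (\<Sum>i<n. \<phi> ((f ^^ i) y) - \<phi> ((f ^^ i) x))"
    by (simp add: birkhoff_sum_def sum_subtractf)
  also have "\<dots> \<le> (\<Sum>i<n. \<delta> + (if ?E i then 2 * B else 0))"
  proof (rule sum_mono)
    fix i
    show "\<phi> ((f ^^ i) y) - \<phi> ((f ^^ i) x) \<le> \<delta> + (if ?E i then 2 * B else 0)"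
      using mod[of "(f ^^ i) x" "(f ^^ i) y"] B[of "(f ^^ i) y"] B[of "(f ^^ i) x"] \<open>\<delta> \<ge> 0\<close>
      by (auto simp: not_le)
  qed
  also have "\<dots> = real n * \<delta> + 2 * B * real (card {i. i < n \<and> ?E i})"
    by (simp add: sum.distrib sum.If_cases Int_def)
  also have "\<dots> \<le> real n * \<delta> + 2 * B * real (g n \<epsilon>)"
  proof -
    have "0 \<le> B" using B[of x] by linarith
    moreover have "real (card {i. i < n \<and> ?E i}) \<le> real (g n \<epsilon>)"
      using y assms(1) by (simp add: mistake_ball_iff)
    ultimately show ?thesis by (intro add_left_mono mult_left_mono) auto
  qed
  finally show "birkhoff_sum f \<phi> n y \<le> birkhoff_sum f \<phi> n x + real n * \<delta> + 2 * B * real (g n \<epsilon>)"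
    by linarith
qed

text \<open>\<open>enat\<close> is well-ordered, so the infimum of a nonempty set is
  attained.\<close>

lemma return_time_cases:
  obtains "return_time f g n x \<epsilon> = \<infinity>"
  | k where "return_time f g n x \<epsilon> = enat k" "k \<ge> 1" "(f ^^ k) x \<in> mistake_ball f g n x \<epsilon>"
proof -
  define A where "A = {enat k | k. k \<ge> 1 \<and> (f ^^ k) x \<in> mistake_ball f g n x \<epsilon>}"
  have R: "return_time f g n x \<epsilon> = Inf A" unfolding return_time_def A_def ..
  show thesis
  proof (cases "A = {}")
    case True
    then show ?thesis using that(1) R by (simp add: top_enat_def)
  next
    case False
    then obtain a where "a \<in> A" by blast
    then have "(LEAST a. a \<in> A) \<in> A" by (rule LeastI)
    then have "return_time f g n x \<epsilon> \<in> A" using False R by (simp add: Inf_enat_def)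
    then obtain k where "return_time f g n x \<epsilon> = enat k" "k \<ge> 1" "(f ^^ k) x \<in> mistake_ball f g n x \<epsilon>"
      unfolding A_def by auto
    then show ?thesis by (rule that(2))
  qed
qed

lemma return_time_le:
  "t \<ge> 1 \<Longrightarrow> (f ^^ t) x \<in> mistake_ball f g n x \<epsilon> \<Longrightarrow> return_time f g n x \<epsilon> \<le> enat t"
  unfolding return_time_def by (rule Inf_lower) blast

definition growth_rate :: "nat \<Rightarrow> real \<Rightarrow> enat \<Rightarrow> ereal" where
  "growth_rate n S R = ereal (1 / real n) * ln_ereal (ereal (exp S) * ereal_of_enat R)"

lemma growth_rate_enat:
  assumes "k \<ge> 1"
  shows "growth_rate n S (enat k) = ereal ((S + ln (real k)) / real n)"
proof -
  have "0 < exp S * real k" using assms by simp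
  then have "ln_ereal (ereal (exp S * real k)) = ereal (ln (exp S * real k))"
    by (simp add: ln_ereal_def not_le)
  then show ?thesis using assms by (simp add: growth_rate_def ln_mult)
qed

text \<open>At \<open>n = 0\<close> the factor is \<open>1 / 0 = 0\<close>, and
  \<open>0 * \<infinity> = 0\<close> in \<open>ereal\<close>.\<close>

lemma growth_rate_infinity: "n \<ge> 1 \<Longrightarrow> growth_rate n S \<infinity> = \<infinity>"
  by (simp add: growth_rate_def ln_ereal_def)

section \<open>From return times to the pressure\<close>

context compact_ergodic
begin

lemma fine_partition:
  assumes "\<epsilon> > 0"
  shows "\<exists>P. finite_measurable_partition M P \<and> (\<forall>B\<in>P. \<forall>x\<in>B. \<forall>y\<in>B. dist x y < \<epsilon>)"
proof -
  have "\<exists>C :: 'a set. finite C \<and> UNIV \<subseteq> (\<Union>z\<in>C. ball z (\<epsilon> / 2))"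
    by (rule conjunct2[OF compact_UNIV[unfolded compact_eq_totally_bounded], rule_format])
      (use assms in simp)
  then obtain C :: "'a set" where C: "finite C" "UNIV \<subseteq> (\<Union>z\<in>C. ball z (\<epsilon> / 2))" by blast
  \<comment> \<open>Cells collect the points lying in the same balls of a finite net; sharing one
    ball of radius \<epsilon>/2 bounds their distance.\<close>
  define s where "s x = {z \<in> C. x \<in> ball z (\<epsilon> / 2)}" for x
  define P where "P = (\<lambda>t. {x. s x = t}) ` Pow C - {{}}"
  have "{x. s x = t} \<in> sets M" if "t \<subseteq> C" for t
  proof -
    have "ball z (\<epsilon> / 2) \<in> sets M" for z by (simp add: sets_borel)
    then have "{x \<in> space M. x \<in> ball z (\<epsilon> / 2) \<longleftrightarrow> z \<in> t} \<in> sets M" for z by measurable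
    then have "{x \<in> space M. \<forall>z\<in>C. x \<in> ball z (\<epsilon> / 2) \<longleftrightarrow> z \<in> t} \<in> sets M"
      by (intro sets.sets_Collect_finite_All C(1))
    also have "{x \<in> space M. \<forall>z\<in>C. x \<in> ball z (\<epsilon> / 2) \<longleftrightarrow> z \<in> t} = {x. s x = t}"
      using that by (auto simp: s_def)
    finally show ?thesis .
  qed
  then have "P \<subseteq> sets M" by (auto simp: P_def)
  moreover have "finite P" using C(1) by (simp add: P_def)
  moreover have "partition_on (space M) P"
  proof (rule partition_onI)
    have "s x \<subseteq> C" for x by (auto simp: s_def)
    then show "\<Union> P = space M" unfolding P_def by auto
  qed (auto simp: P_def disjnt_def)
  moreover have "dist x y < \<epsilon>" if "B \<in> P" "x \<in> B" "y \<in> B" for B x y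
  proof -
    obtain z where "z \<in> C" "x \<in> ball z (\<epsilon> / 2)" using C(2) by blast
    then have "z \<in> s x" by (simp add: s_def)
    moreover have "s x = s y" using that by (auto simp: P_def)
    ultimately have "dist z x < \<epsilon> / 2" "dist z y < \<epsilon> / 2" by (auto simp: s_def)
    then show ?thesis using dist_triangle_half_r by blast
  qed
  ultimately show ?thesis unfolding finite_measurable_partition_def by blast
qed

lemma entropy_le_measure_entropy:
  "finite_measurable_partition M P \<Longrightarrow> ereal (entropy_wrt_partition M f P) \<le> measure_entropy M f"
  unfolding measure_entropy_def by (rule SUP_upper) simp

text \<open>Some finite measurable partition exists, so the supremum is not empty. This excludes
  undefined cases when the integral is moved across inequalities in \<open>ereal\<close>.\<close>

lemma measure_entropy_not_MInf: "measure_entropy M f \<noteq> - \<infinity>"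
  using fine_partition[of 1] entropy_le_measure_entropy by fastforce

text \<open>With cells of diameter below \<epsilon>, a return to the cylinder is a return without
  any mistake.\<close>

lemma AE_return_bowen:
  assumes "measure_entropy M f < ereal d" and "\<epsilon> > 0"
  shows "AE x in M. \<forall>\<^sub>F n in sequentially. \<exists>t\<ge>1. real t \<le> exp (d * real n) \<and>
    (\<forall>i<n. dist ((f ^^ i) x) ((f ^^ (i + t)) x) < \<epsilon>)"
proof -
  obtain P where P: "finite_measurable_partition M P" and
    small: "\<And>B x y. B \<in> P \<Longrightarrow> x \<in> B \<Longrightarrow> y \<in> B \<Longrightarrow> dist x y < \<epsilon>"
    using fine_partition[OF \<open>\<epsilon> > 0\<close>] by blast
  interpret L: labelled_mpt M f P "cell_of P" by (rule labelled_mpt_cell_of[OF P])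
  interpret E: ergodic_labelled_mpt M f P "cell_of P" by unfold_locales
  have "ereal L.entropy_rate < ereal d"
    using entropy_le_measure_entropy[OF P] assms(1) unfolding entropy_wrt_partition_eq[OF P]
    by (rule order_le_less_trans)
  then have "AE x in M. \<forall>\<^sub>F n in sequentially. \<exists>t\<ge>1. real t \<le> exp (d * real n) \<and>
      L.itin n ((f ^^ t) x) = L.itin n x"
    by (intro E.return_time_upper) simp
  then show ?thesis
  proof eventually_elim
    case (elim x)
    from elim show ?case
    proof eventually_elim
      case (elim n)
      then obtain t where t: "t \<ge> 1" "real t \<le> exp (d * real n)" "L.itin n ((f ^^ t) x) = L.itin n x"
        by blast
      have "dist ((f ^^ i) x) ((f ^^ (i + t)) x) < \<epsilon>" if "i < n" for i
      proof -
        have "cell_of P ((f ^^ (i + t)) x) = cell_of P ((f ^^ i) x)"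
          using t(3) that by (simp add: itinerary_eq_iff funpow_add)
        then have "(f ^^ (i + t)) x \<in> cell_of P ((f ^^ i) x)" "(f ^^ i) x \<in> cell_of P ((f ^^ i) x)"
          using cell_of_eq[OF P cell_of_in[OF P]] by blast+
        then show ?thesis using small[OF cell_of_in[OF P]] by blast
      qed
      then show ?case using t by blast
    qed
  qed
qed

text \<open>One scale \<open>e\<close> at which quick returns fail infinitely often serves all
  smaller \<epsilon>: errors at distance \<open>e\<close> are errors at distance \<epsilon>, and the
  permitted number \<open>G n \<epsilon>\<close> is eventually below \<open>e * n\<close>. A smaller
  limsup would force quick returns at scale \<open>e\<close> for all large \<open>n\<close>.\<close>

lemma growth_rate_lower:
  assumes x: "x \<notin> quickly_returning q" and B: "\<And>y. \<bar>\<phi> y\<bar> \<le> B"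
    and I: "(\<lambda>n. birkhoff_sum f \<phi> n x / real n) \<longlonglongrightarrow> I" and l: "l < ereal (q + I)"
    and G: "\<And>\<epsilon>. 0 < \<epsilon> \<Longrightarrow> \<epsilon> \<le> \<epsilon>\<^sub>0 \<Longrightarrow> (\<lambda>n. real (G n \<epsilon>) / real n) \<longlonglongrightarrow> 0" and "\<epsilon>\<^sub>0 > 0"
  shows "\<forall>\<^sub>F \<epsilon> in at_right 0. l < limsup (\<lambda>n. growth_rate n
    (birkhoff_sup f \<phi> n (mistake_ball f G n x \<epsilon>)) (return_time f G n x \<epsilon>))"
proof -
  obtain m where m: "\<not> (\<forall>\<^sub>F n in sequentially. x \<in> quick_returns q (1 / Suc m) n)"
    using x unfolding quickly_returning_def by blast
  define e where "e = 1 / real (Suc m)"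
  have "e > 0" by (simp add: e_def)
  have "l < limsup (\<lambda>n. growth_rate n
      (birkhoff_sup f \<phi> n (mistake_ball f G n x \<epsilon>)) (return_time f G n x \<epsilon>))" (is "_ < limsup ?V")
    if \<epsilon>: "0 < \<epsilon>" "\<epsilon> < min e \<epsilon>\<^sub>0" for \<epsilon>
  proof (rule ccontr)
    assume "\<not> l < limsup ?V"
    then have "limsup ?V < ereal (q + I)" using l by simp
    then obtain r where r: "limsup ?V < ereal r" "r < q + I" using ereal_dense2 by force
    have "\<forall>\<^sub>F n in sequentially. r - q < birkhoff_sum f \<phi> n x / real n"
      using order_tendstoD(1)[OF I, of "r - q"] r(2) by simp
    moreover have "\<forall>\<^sub>F n in sequentially. real (G n \<epsilon>) / real n < e"
      using order_tendstoD(2)[OF G[of \<epsilon>], of e] \<epsilon> \<open>e > 0\<close> by simp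
    ultimately have "\<forall>\<^sub>F n in sequentially. x \<in> quick_returns q e n"
      using Limsup_lessD[OF r(1)] eventually_ge_at_top[of 1]
    proof eventually_elim
      case (elim n)
      let ?S = "birkhoff_sup f \<phi> n (mistake_ball f G n x \<epsilon>)"
      show ?case
      proof (rule ccontr)
        assume slow: "x \<notin> quick_returns q e n"
        show False
        proof (cases rule: return_time_cases[of f G n x \<epsilon>])
          case 1
          then show ?thesis using elim(3,4) by (simp add: growth_rate_infinity)
        next
          case (2 k)
          have "near_return e n k x"
          proof -
            have "card {i. i < n \<and> e \<le> dist ((f ^^ i) x) ((f ^^ (i + k)) x)} \<le>
                card {i. i < n \<and> \<epsilon> \<le> dist ((f ^^ i) x) ((f ^^ i) ((f ^^ k) x))}"
              using \<epsilon> by (intro card_mono) (auto simp: funpow_add)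
            also have "\<dots> \<le> G n \<epsilon>" using 2(3) \<epsilon> by (simp add: mistake_ball_iff)
            also have "real (G n \<epsilon>) \<le> e * real n" using elim(2,4) by (simp add: divide_simps)
            finally show ?thesis by (simp add: near_return_def)
          qed
          then have "exp ((q + e) * real n) < real k"
            using slow 2(2) unfolding quick_returns_def by force
          then have "(q + e) * real n \<le> ln (real k)" using 2(2) by (simp add: ln_ge_iff)
          moreover have "q * real n \<le> (q + e) * real n" using \<open>e > 0\<close> by (simp add: distrib_right)
          moreover have "(r - q) * real n < birkhoff_sum f \<phi> n x"
            using elim(1,4) by (simp add: pos_less_divide_eq)
          ultimately have "r * real n < ?S + ln (real k)"
            using birkhoff_sup_ge[where \<phi> = \<phi> and f = f and n = n and x = x and g = G, OF \<epsilon>(1) B] by (simp add: algebra_simps)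
          then have "r < (?S + ln (real k)) / real n" using elim(4) by (simp add: pos_less_divide_eq)
          then show False using elim(3) 2 by (simp add: growth_rate_enat)
        qed
      qed
    qed
    then show False using m by (simp add: e_def)
  qed
  then show ?thesis
    unfolding eventually_at_right_field using \<open>e > 0\<close> \<open>\<epsilon>\<^sub>0 > 0\<close> by (intro exI[of _ "min e \<epsilon>\<^sub>0"]) auto
qed

lemma growth_rate_upper:
  assumes x: "\<And>m. \<forall>\<^sub>F n in sequentially. \<exists>t\<ge>1. real t \<le> exp (d * real n) \<and>
      (\<forall>i<n. dist ((f ^^ i) x) ((f ^^ (i + t)) x) < 1 / Suc m)"
    and B: "\<And>y. \<bar>\<phi> y\<bar> \<le> B" and cont: "uniformly_continuous_on UNIV \<phi>"
    and I: "(\<lambda>n. birkhoff_sum f \<phi> n x / real n) \<longlonglongrightarrow> I" and u: "ereal (d + I) < u"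
    and G: "\<And>\<epsilon>. 0 < \<epsilon> \<Longrightarrow> \<epsilon> \<le> \<epsilon>\<^sub>0 \<Longrightarrow> (\<lambda>n. real (G n \<epsilon>) / real n) \<longlonglongrightarrow> 0" and "\<epsilon>\<^sub>0 > 0"
  shows "\<forall>\<^sub>F \<epsilon> in at_right 0. limsup (\<lambda>n. growth_rate n
    (birkhoff_sup f \<phi> n (mistake_ball f G n x \<epsilon>)) (return_time f G n x \<epsilon>)) < u"
proof -
  obtain v where v: "d + I < v" "ereal v < u" using ereal_dense2[OF u] by auto
  \<comment> \<open>The three shares go to the Birkhoff average at \<open>x\<close>, the oscillation
    of \<phi> at good times, and the mistakes.\<close>
  define \<delta> where "\<delta> = (v - d - I) / 3"
  have \<delta>: "\<delta> > 0" using v(1) by (simp add: \<delta>_def)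
  obtain e where e: "e > 0" "\<And>y z. dist y z < e \<Longrightarrow> dist (\<phi> y) (\<phi> z) < \<delta>"
    by (rule uniformly_continuous_onE[OF cont \<delta>], rule that) auto
  have "limsup (\<lambda>n. growth_rate n
      (birkhoff_sup f \<phi> n (mistake_ball f G n x \<epsilon>)) (return_time f G n x \<epsilon>)) < u" (is "limsup ?V < _")
    if \<epsilon>: "0 < \<epsilon>" "\<epsilon> < min e \<epsilon>\<^sub>0" for \<epsilon>
  proof -
    obtain m where m: "1 / real (Suc m) < \<epsilon>" using nat_approx_posE[OF \<epsilon>(1)] by blast
    have mod: "\<bar>\<phi> y - \<phi> z\<bar> \<le> \<delta>" if "dist y z < \<epsilon>" for y z
      using e(2)[of y z] that \<epsilon> by (simp add: dist_real_def)
    have "(\<lambda>n. 2 * B * (real (G n \<epsilon>) / real n)) \<longlonglongrightarrow> 2 * B * 0"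
      using \<epsilon> by (intro tendsto_mult_left G) auto
    then have "\<forall>\<^sub>F n in sequentially. 2 * B * (real (G n \<epsilon>) / real n) < \<delta>"
      using \<delta> by (intro order_tendstoD(2)) auto
    moreover have "\<forall>\<^sub>F n in sequentially. birkhoff_sum f \<phi> n x / real n < I + \<delta>"
      using order_tendstoD(2)[OF I, of "I + \<delta>"] \<delta> by simp
    ultimately have "\<forall>\<^sub>F n in sequentially. ?V n \<le> ereal v"
      using x[of m] eventually_ge_at_top[of 1]
    proof eventually_elim
      case (elim n)
      let ?S = "birkhoff_sup f \<phi> n (mistake_ball f G n x \<epsilon>)"
      obtain t where t: "t \<ge> 1" "real t \<le> exp (d * real n)"
        "\<And>i. i < n \<Longrightarrow> dist ((f ^^ i) x) ((f ^^ (i + t)) x) < 1 / Suc m"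
        using elim(3) by blast
      \<comment> \<open>A return without mistakes lies in the mistake ball whatever the value of
        \<open>G n \<epsilon>\<close>.\<close>
      have "{i. i < n \<and> \<epsilon> \<le> dist ((f ^^ i) x) ((f ^^ i) ((f ^^ t) x))} = {}"
        using t(3) m by (force simp: funpow_add)
      then have "(f ^^ t) x \<in> mistake_ball f G n x \<epsilon>"
        unfolding mistake_ball_iff[OF \<epsilon>(1)] by (simp only: card.empty)
      then have "return_time f G n x \<epsilon> \<le> enat t" by (rule return_time_le[OF t(1)])
      then obtain k where k: "return_time f G n x \<epsilon> = enat k" "k \<ge> 1" "k \<le> t"
        by (cases rule: return_time_cases[of f G n x \<epsilon>]) auto
      have "real k \<le> exp (d * real n)" using k(3) t(2) by linarith
      then have "ln (real k) \<le> d * real n" using k(2) ln_mono[of "real k"] by fastforce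
      moreover have "?S \<le> birkhoff_sum f \<phi> n x + real n * \<delta> + 2 * B * real (G n \<epsilon>)"
        by (rule birkhoff_sup_le[where \<phi> = \<phi>, OF \<epsilon>(1) B mod]) (use \<delta> in auto)
      moreover have "birkhoff_sum f \<phi> n x \<le> (I + \<delta>) * real n"
        using elim(2,4) by (simp add: divide_simps)
      moreover have "2 * B * real (G n \<epsilon>) \<le> \<delta> * real n"
        using elim(1,4) by (simp add: divide_simps)
      moreover have "v = d + I + 3 * \<delta>" by (simp add: \<delta>_def field_simps)
      ultimately have "?S + ln (real k) \<le> v * real n" by (simp add: algebra_simps)
      then have "(?S + ln (real k)) / real n \<le> v" using elim(4) by (simp add: divide_simps)
      then show ?case using k by (simp add: growth_rate_enat)
    qed
    then have "limsup ?V \<le> ereal v" by (rule Limsup_bounded)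
    then show ?thesis using v(2) by simp
  qed
  then show ?thesis
    unfolding eventually_at_right_field using e(1) \<open>\<epsilon>\<^sub>0 > 0\<close> by (intro exI[of _ "min e \<epsilon>\<^sub>0"]) auto
qed

theorem pressure_return_time:
  assumes cont: "continuous_on UNIV \<phi>"
    and G: "\<And>\<epsilon>. 0 < \<epsilon> \<Longrightarrow> \<epsilon> \<le> \<epsilon>\<^sub>0 \<Longrightarrow> (\<lambda>n. real (G n \<epsilon>) / real n) \<longlonglongrightarrow> 0" and "\<epsilon>\<^sub>0 > 0"
  shows "AE x in M. ((\<lambda>\<epsilon>. limsup (\<lambda>n. growth_rate n
    (birkhoff_sup f \<phi> n (mistake_ball f G n x \<epsilon>)) (return_time f G n x \<epsilon>)))
      \<longlongrightarrow> measure_pressure M f \<phi>) (at_right 0)"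
proof -
  have unif: "uniformly_continuous_on UNIV \<phi>"
    by (rule compact_uniformly_continuous[OF cont compact_UNIV])
  have "bounded (range \<phi>)" using compact_continuous_image[OF cont compact_UNIV] by (rule compact_imp_bounded)
  then obtain B where B: "\<And>y. \<bar>\<phi> y\<bar> \<le> B" unfolding bounded_iff by auto
  define h where "h = measure_entropy M f"
  define I where "I = (\<integral>x. \<phi> x \<partial>M)"
  have "AE x in M. (\<lambda>n. birkhoff_sum f \<phi> n x / real n) \<longlonglongrightarrow> I"
    unfolding I_def by (rule birkhoff[OF continuous_measurable[OF cont] B])
  \<comment> \<open>Rational levels leave one null set for all bounds and include the case of
    infinite entropy, where the upper statement is vacuous.\<close>
  moreover have "AE x in M. \<forall>q::rat. ereal (real_of_rat q) < h \<longrightarrow> x \<notin> quickly_returning (real_of_rat q)"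
    unfolding AE_all_countable h_def using AE_not_quickly_returning by (auto intro!: AE_impI)
  moreover have "AE x in M. \<forall>q::rat. h < ereal (real_of_rat q) \<longrightarrow>
      (\<forall>m. \<forall>\<^sub>F n in sequentially. \<exists>t\<ge>1. real t \<le> exp (real_of_rat q * real n) \<and>
        (\<forall>i<n. dist ((f ^^ i) x) ((f ^^ (i + t)) x) < 1 / Suc m))"
    unfolding AE_all_countable h_def
    by (intro allI AE_impI AE_all_countable[THEN iffD2] AE_return_bowen) simp_all
  ultimately show ?thesis
  proof eventually_elim
    case (elim x)
    have h: "h \<noteq> - \<infinity>" unfolding h_def by (rule measure_entropy_not_MInf)
    have pressure: "measure_pressure M f \<phi> = h + ereal I"
      by (simp add: measure_pressure_def h_def I_def)
    show ?case unfolding pressure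
    proof (rule order_tendstoI)
      fix l assume "l < h + ereal I"
      then have "l - ereal I < h" by (cases l; cases h) auto
      then obtain q :: rat where q: "l - ereal I < ereal (real_of_rat q)" "ereal (real_of_rat q) < h"
        using ereal_dense3 by blast
      have "l < ereal (real_of_rat q + I)" using q(1) by (cases l) auto
      with elim(2) q(2) elim(1) show "\<forall>\<^sub>F \<epsilon> in at_right 0. l < limsup (\<lambda>n. growth_rate n
          (birkhoff_sup f \<phi> n (mistake_ball f G n x \<epsilon>)) (return_time f G n x \<epsilon>))"
        by (intro growth_rate_lower[OF _ B _ _ G \<open>\<epsilon>\<^sub>0 > 0\<close>]) auto
    next
      fix u assume "h + ereal I < u"
      then have "h < u - ereal I" using h by (cases u; cases h) auto
      then obtain q :: rat where q: "h < ereal (real_of_rat q)" "ereal (real_of_rat q) < u - ereal I"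
        using ereal_dense3 by blast
      have "ereal (real_of_rat q + I) < u" using q(2) by (cases u) auto
      with elim(3) q(1) elim(1) show "\<forall>\<^sub>F \<epsilon> in at_right 0. limsup (\<lambda>n. growth_rate n
          (birkhoff_sup f \<phi> n (mistake_ball f G n x \<epsilon>)) (return_time f G n x \<epsilon>)) < u"
        by (intro growth_rate_upper[OF _ B unif _ _ G \<open>\<epsilon>\<^sub>0 > 0\<close>]) auto
    qed
  qed
qed

end

theorem corollary2:
  fixes f :: "'a::metric_space \<Rightarrow> 'a"
    and \<mu> :: "'a measure"
    and \<phi> :: "'a \<Rightarrow> real"
    and g :: "nat \<Rightarrow> real \<Rightarrow> nat"
    and \<epsilon>\<^sub>0 :: real
  assumes "compact (UNIV :: 'a set)"
    and "continuous_on UNIV f"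
    and "prob_space \<mu>" and "sets \<mu> = sets borel"
    and "invariant_measure f \<mu>" and "ergodic_measure f \<mu>"
    and "continuous_on UNIV \<phi>"
    and "mistake_function \<epsilon>\<^sub>0 g"
  shows "AE x in \<mu>.
    ((\<lambda>\<epsilon>. limsup (\<lambda>n. ereal (1 / real n) *
        ln_ereal (ereal (exp (birkhoff_sup f \<phi> n (mistake_ball f (extend_mistake \<epsilon>\<^sub>0 g) n x \<epsilon>)))
                  * ereal_of_enat (return_time f (extend_mistake \<epsilon>\<^sub>0 g) n x \<epsilon>))))
      \<longlongrightarrow> measure_pressure \<mu> f \<phi>) (at_right 0)"
proof -
  have "space \<mu> = UNIV" using sets_eq_imp_space_eq[OF assms(4)] by simp
  then interpret compact_ergodic \<mu> f
    using assms by (intro compact_ergodic.intro ergodic_mpt.intro mpt.intro mpt_axioms.intro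
      ergodic_mpt_axioms.intro compact_ergodic_axioms.intro) (simp_all add: invariant_measure_def)
  have "\<epsilon>\<^sub>0 > 0" using assms(8) by (simp add: mistake_function_def)
  moreover have "(\<lambda>n. real (extend_mistake \<epsilon>\<^sub>0 g n \<epsilon>) / real n) \<longlonglongrightarrow> 0" if "0 < \<epsilon>" "\<epsilon> \<le> \<epsilon>\<^sub>0" for \<epsilon>
    using assms(8) that by (simp add: mistake_function_def extend_mistake_def)
  ultimately show ?thesis
    using pressure_return_time[OF assms(7), of \<epsilon>\<^sub>0 "extend_mistake \<epsilon>\<^sub>0 g"]
    unfolding growth_rate_def by blast
qed

end
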